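(* There is a $2^{2^{x^{\varepsilon}}}$ speedup of $\mathsf{PrA}$ over $\mathsf{PrA}_{\mathit{alt}}$. That is, there exist a constant $\varepsilon>0$ and a sequence of sentences $(\varphi_i)_{i<\omega}$ of the language $\mathcal{L}_{\mathsf{PrA}}$ such that the length of $\varphi_i$ is bounded by a polynomial in $i$, each $\varphi_i$ has a proof in $\mathsf{PrA}$ of length bounded by a polynomial in $i$, but every proof of $\varphi_i$ in $\mathsf{PrA}_{\mathit{alt}}$ has length at least $2^{2^{i^{\varepsilon}}}$.
   Context: $\mathcal{L}_{\mathsf{PrA}}$ is the first-order language with equality, constants $0,1$ and the binary function symbol $+$. $\mathsf{PrA}^-$ is the theory with axioms: (1) the axioms of a cancellative Abelian semigroup with neutral element $0$ for $+$; (2) $\forall x\; x+1\neq 0$; (3) $\forall x\,(x\neq 0\rightarrow \exists y\; x=y+1)$; (4) $\forall x,y\,(x\le y\vee y\le x)$, where $x\le y$ abbreviates $\exists z\; x+z=y$. $\mathsf{PrA}$ is $\mathsf{PrA}^-$ together with the induction schema: for every $\mathcal{L}_{\mathsf{PrA}}$-formula $\phi(x)$ (possibly with other free variables), the axiom $\phi(0)\wedge\forall x(\phi(x)\rightarrow\phi(x+1))\rightarrow\forall x\,\phi(x)$. $\mathsf{PrA}_{\mathit{alt}}$ is $\mathsf{PrA}^-$ together with, for each prime $p$, the axiom $\forall x\,(x\equiv_p 0\vee\dots\vee x\equiv_p p-1)$, where $x\equiv_n s$ abbreviates $\exists z\,(\underbrace{z+\dots+z}_{n}+s=x\;\vee\;\underbrace{z+\dots+z}_{n}+x=s)$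 and natural numbers are written as sums of $1$'s. Proofs are taken in any fixed standard proof system for first-order logic such as a Hilbert-style system, natural deduction, or sequent calculus with cut (these are polynomially equivalent). Length (size) of formulas and proofs is the number of characters. *)

theory Defs
  imports Complex_Main
    "HOL-Computational_Algebra.Primes"
    "HOL-Computational_Algebra.Polynomial"
begin

section \<open>The language of Presburger arithmetic\<close>

text \<open>Variables are named, \<open>Var n\<close> being the \<open>n\<close>-th variable. The primitive logical symbols are
  equality, negation, implication and the universal quantifier. Each of the other connectives below
  uses its arguments exactly once, so it abbreviates with only a constant overhead in length.\<close>

datatype tm = Var nat | Zero | One | Add tm tm

datatype fm = Eq tm tm | Neg fm | Imp fm fm | Forall nat fm

abbreviation Dis :: "fm \<Rightarrow> fm \<Rightarrow> fm" where
  "Dis \<phi> \<psi> \<equiv> Imp (Neg \<phi>) \<psi>"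

abbreviation Con :: "fm \<Rightarrow> fm \<Rightarrow> fm" where
  "Con \<phi> \<psi> \<equiv> Neg (Imp \<phi> (Neg \<psi>))"

abbreviation Exists :: "nat \<Rightarrow> fm \<Rightarrow> fm" where
  "Exists x \<phi> \<equiv> Neg (Forall x (Neg \<phi>))"

fun Disj :: "fm list \<Rightarrow> fm" where
  "Disj [] = Neg (Eq Zero Zero)"
| "Disj [\<phi>] = \<phi>"
| "Disj (\<phi> # \<psi> # \<phi>s) = Dis \<phi> (Disj (\<psi> # \<phi>s))"

fun vars_tm :: "tm \<Rightarrow> nat set" where
  "vars_tm (Var x) = {x}"
| "vars_tm Zero = {}"
| "vars_tm One = {}"
| "vars_tm (Add s t) = vars_tm s \<union> vars_tm t"

fun free_vars :: "fm \<Rightarrow> nat set" where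
  "free_vars (Eq s t) = vars_tm s \<union> vars_tm t"
| "free_vars (Neg \<phi>) = free_vars \<phi>"
| "free_vars (Imp \<phi> \<psi>) = free_vars \<phi> \<union> free_vars \<psi>"
| "free_vars (Forall x \<phi>) = free_vars \<phi> - {x}"

definition sentence :: "fm \<Rightarrow> bool" where
  "sentence \<phi> \<longleftrightarrow> free_vars \<phi> = {}"

fun subst_tm :: "nat \<Rightarrow> tm \<Rightarrow> tm \<Rightarrow> tm" where
  "subst_tm x t (Var y) = (if y = x then t else Var y)"
| "subst_tm x t Zero = Zero"
| "subst_tm x t One = One"
| "subst_tm x t (Add r s) = Add (subst_tm x t r) (subst_tm x t s)"

text \<open>Replacement of the free occurrences of \<open>x\<close> by \<open>t\<close>, without renaming of bound variables;
  \<open>free_for t x \<phi>\<close> says that no variable of \<open>t\<close> gets captured.\<close>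

fun subst :: "nat \<Rightarrow> tm \<Rightarrow> fm \<Rightarrow> fm" where
  "subst x t (Eq r s) = Eq (subst_tm x t r) (subst_tm x t s)"
| "subst x t (Neg \<phi>) = Neg (subst x t \<phi>)"
| "subst x t (Imp \<phi> \<psi>) = Imp (subst x t \<phi>) (subst x t \<psi>)"
| "subst x t (Forall y \<phi>) = (if y = x then Forall y \<phi> else Forall y (subst x t \<phi>))"

fun free_for :: "tm \<Rightarrow> nat \<Rightarrow> fm \<Rightarrow> bool" where
  "free_for t x (Eq r s) \<longleftrightarrow> True"
| "free_for t x (Neg \<phi>) \<longleftrightarrow> free_for t x \<phi>"
| "free_for t x (Imp \<phi> \<psi>) \<longleftrightarrow> free_for t x \<phi> \<and> free_for t x \<psi>"
| "free_for t x (Forall y \<phi>) \<longleftrightarrow>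
     x \<notin> free_vars (Forall y \<phi>) \<or> (y \<notin> vars_tm t \<and> free_for t x \<phi>)"


section \<open>Written form and length\<close>

text \<open>Formulas and proofs are written over a finite alphabet, so a variable is written as the letter
  \<open>x\<close> followed by its index in binary.\<close>

fun binary :: "nat \<Rightarrow> string" where
  "binary n = (if n < 2 then [] else binary (n div 2)) @ (if even n then ''0'' else ''1'')"

declare binary.simps [simp del]

fun write_tm :: "tm \<Rightarrow> string" where
  "write_tm (Var n) = ''x'' @ binary n"
| "write_tm Zero = ''0''"
| "write_tm One = ''1''"
| "write_tm (Add s t) = ''('' @ write_tm s @ ''+'' @ write_tm t @ '')''"

fun write_fm :: "fm \<Rightarrow> string" where
  "write_fm (Eq s t) = ''('' @ write_tm s @ ''='' @ write_tm t @ '')''"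
| "write_fm (Neg \<phi>) = ''~'' @ write_fm \<phi>"
| "write_fm (Imp \<phi> \<psi>) = ''('' @ write_fm \<phi> @ ''>'' @ write_fm \<psi> @ '')''"
| "write_fm (Forall n \<phi>) = ''Ax'' @ binary n @ write_fm \<phi>"

definition fm_length :: "fm \<Rightarrow> nat" where
  "fm_length \<phi> = length (write_fm \<phi>)"

definition write_proof :: "fm list \<Rightarrow> string" where
  "write_proof \<pi> = concat (map (\<lambda>\<phi>. write_fm \<phi> @ '';'') \<pi>)"

definition proof_length :: "fm list \<Rightarrow> nat" where
  "proof_length \<pi> = length (write_proof \<pi>)"


section \<open>A Hilbert-style proof system\<close>

text \<open>This is the usual calculus for first-order logic with equality whose rules are modus ponens and
  unrestricted generalization.\<close>

inductive logical_axiom :: "fm \<Rightarrow> bool" where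
  "logical_axiom (Imp \<phi> (Imp \<psi> \<phi>))"
| "logical_axiom (Imp (Imp \<phi> (Imp \<psi> \<chi>)) (Imp (Imp \<phi> \<psi>) (Imp \<phi> \<chi>)))"
| "logical_axiom (Imp (Imp (Neg \<phi>) (Neg \<psi>)) (Imp \<psi> \<phi>))"
| "free_for t x \<phi> \<Longrightarrow> logical_axiom (Imp (Forall x \<phi>) (subst x t \<phi>))"
| "x \<notin> free_vars \<phi> \<Longrightarrow> logical_axiom (Imp (Forall x (Imp \<phi> \<psi>)) (Imp \<phi> (Forall x \<psi>)))"
| "logical_axiom (Eq t t)"
| "free_for s x \<phi> \<Longrightarrow> free_for t x \<phi> \<Longrightarrow>
     logical_axiom (Imp (Eq s t) (Imp (subst x s \<phi>) (subst x t \<phi>)))"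

definition proof_in :: "fm set \<Rightarrow> fm list \<Rightarrow> bool" where
  "proof_in T \<pi> \<longleftrightarrow> (\<forall>i < length \<pi>.
     logical_axiom (\<pi> ! i) \<or> \<pi> ! i \<in> T \<or>
     (\<exists>j<i. \<exists>k<i. \<pi> ! k = Imp (\<pi> ! j) (\<pi> ! i)) \<or>
     (\<exists>j<i. \<exists>x. \<pi> ! i = Forall x (\<pi> ! j)))"

definition proves_by :: "fm set \<Rightarrow> fm list \<Rightarrow> fm \<Rightarrow> bool" where
  "proves_by T \<pi> \<phi> \<longleftrightarrow> proof_in T \<pi> \<and> \<pi> \<noteq> [] \<and> last \<pi> = \<phi>"


section \<open>The theories\<close>

text \<open>\<open>mult_tm n t\<close> is \<open>(t + t) + \<dots> + t\<close> with \<open>n\<close> summands. In \<open>le_fm\<close> and \<open>cong_fm\<close> the bound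
  variable \<open>z\<close> is meant not to occur in the terms.\<close>

fun mult_tm :: "nat \<Rightarrow> tm \<Rightarrow> tm" where
  "mult_tm 0 t = Zero"
| "mult_tm (Suc 0) t = t"
| "mult_tm (Suc (Suc n)) t = Add (mult_tm (Suc n) t) t"

definition numeral_tm :: "nat \<Rightarrow> tm" where
  "numeral_tm n = mult_tm n One"

definition le_fm :: "nat \<Rightarrow> tm \<Rightarrow> tm \<Rightarrow> fm" where
  "le_fm z s t = Exists z (Eq (Add s (Var z)) t)"

definition cong_fm :: "nat \<Rightarrow> nat \<Rightarrow> tm \<Rightarrow> tm \<Rightarrow> fm" where
  "cong_fm z n t s =
     Exists z (Dis (Eq (Add (mult_tm n (Var z)) s) t) (Eq (Add (mult_tm n (Var z)) t) s))"

definition PrA_minus :: "fm set" where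
  "PrA_minus = (let x = Var 0; y = Var 1; z = Var 2 in
    {Forall 0 (Forall 1 (Forall 2 (Eq (Add (Add x y) z) (Add x (Add y z))))),
     Forall 0 (Forall 1 (Eq (Add x y) (Add y x))),
     Forall 0 (Eq (Add x Zero) x),
     Forall 0 (Forall 1 (Forall 2 (Imp (Eq (Add x z) (Add y z)) (Eq x y)))),
     Forall 0 (Neg (Eq (Add x One) Zero)),
     Forall 0 (Imp (Neg (Eq x Zero)) (Exists 1 (Eq x (Add y One)))),
     Forall 0 (Forall 1 (Dis (le_fm 2 x y) (le_fm 2 y x)))})"

text \<open>No variable can be captured in the two substitutions of the induction axiom, since the terms
  \<open>0\<close> and \<open>x + 1\<close> contain no variable other than \<open>x\<close>.\<close>

definition induction_axiom :: "nat \<Rightarrow> fm \<Rightarrow> fm" where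
  "induction_axiom x \<phi> =
     Imp (Con (subst x Zero \<phi>) (Forall x (Imp \<phi> (subst x (Add (Var x) One) \<phi>)))) (Forall x \<phi>)"

definition PrA :: "fm set" where
  "PrA = PrA_minus \<union> {induction_axiom x \<phi> | x \<phi>. True}"

definition mod_axiom :: "nat \<Rightarrow> fm" where
  "mod_axiom p = Forall 0 (Disj (map (\<lambda>r. cong_fm 1 p (Var 0) (numeral_tm r)) [0..<p]))"

definition PrA_alt :: "fm set" where
  "PrA_alt = PrA_minus \<union> {mod_axiom p | p. prime p}"

end

theory Submission
  imports Defs "HOL-Library.Countable"
begin

text \<open>
  The sentence \<open>speedup_fm n\<close> says that every number can be divided with remainder by every nonzero \<open>a\<close>
  that is recognized by the multiplication formula \<open>mult_fm n a q y\<close>. The latter defines \<open>a \<cdot> q = y\<close> for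
  certain numbers \<open>a\<close>, which include all those up to \<open>2 ^ 2 ^ (n - 1)\<close>, although its length is only quadratic
  in \<open>n\<close>: one level writes \<open>a = c v + w\<close>, hence \<open>a q = c (v q) + w q\<close>, and the device of Fischer and Rabin
  expresses the four multiplications by one copy of the preceding formula.

  Proofs in the alternative theory are long. The axiom for a prime \<open>p\<close> is a disjunction of \<open>p\<close> formulas, so a proof
  shorter than \<open>N\<close> contains axioms for primes below \<open>N\<close> only. All of these hold in the nonnegative part of the
  lexicographic product of the rationals with \<open>N\<close>-smooth denominators and the integers (\<open>sem_mod_axiom\<close>). There
  the element \<open>(1, 0)\<close> cannot be divided with remainder by a prime \<open>P \<ge> N\<close>, so the sentence fails as soon
  as it speaks about such a \<open>P\<close> (\<open>speedup_fm_fails\<close>). A Chebyshev estimate gives a prime between \<open>N\<close> and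
  \<open>2 N\<^sup>2\<close> for powers \<open>N \<ge> 8\<close> of 2 (\<open>prime_in_interval\<close>), and this is within the range of the formula for a
  doubly exponential \<open>N\<close>.

  With induction the proofs are short. By induction on the level, multiplication is total, functional and
  additive in the second factor (\<open>mult_theory\<close>), and division with remainder follows by induction on the
  dividend. The point is that the passage from one level to the next is uniform. With a relation symbol in place
  of the preceding multiplication formula it becomes one valid first-order sentence (\<open>prov_step\<close>), which has
  a derivation by the completeness theorem (\<open>completeness\<close>). This derivation is a fixed object, and
  substituting the multiplication formula for the symbol turns it into a proof whose length is at most a constant
  times the square of a bound on the size of that formula (\<open>translate\<close>). So the steps up to level \<open>n\<close>
  together have polynomial length.
\<close>

section \<open>First-order logic with a relation symbol\<close>

text \<open>The language of Presburger arithmetic with one more ternary relation symbol \<open>PRel\<close>. The symbol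
  stands for a multiplication formula that grows along the construction, so that an argument about all
  these formulas can be one derivation in this language.\<close>

datatype pfm = PEq tm tm | PRel tm tm tm | PNeg pfm | PImp pfm pfm | PAll nat pfm

abbreviation PCon :: "pfm \<Rightarrow> pfm \<Rightarrow> pfm" where
  "PCon \<phi> \<psi> \<equiv> PNeg (PImp \<phi> (PNeg \<psi>))"

abbreviation PDis :: "pfm \<Rightarrow> pfm \<Rightarrow> pfm" where
  "PDis \<phi> \<psi> \<equiv> PImp (PNeg \<phi>) \<psi>"

abbreviation PEx :: "nat \<Rightarrow> pfm \<Rightarrow> pfm" where
  "PEx x \<phi> \<equiv> PNeg (PAll x (PNeg \<phi>))"

fun pfree_vars :: "pfm \<Rightarrow> nat set" where
  "pfree_vars (PEq s t) = vars_tm s \<union> vars_tm t"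
| "pfree_vars (PRel r s t) = vars_tm r \<union> vars_tm s \<union> vars_tm t"
| "pfree_vars (PNeg \<phi>) = pfree_vars \<phi>"
| "pfree_vars (PImp \<phi> \<psi>) = pfree_vars \<phi> \<union> pfree_vars \<psi>"
| "pfree_vars (PAll x \<phi>) = pfree_vars \<phi> - {x}"

fun pvars :: "pfm \<Rightarrow> nat set" where
  "pvars (PEq s t) = vars_tm s \<union> vars_tm t"
| "pvars (PRel r s t) = vars_tm r \<union> vars_tm s \<union> vars_tm t"
| "pvars (PNeg \<phi>) = pvars \<phi>"
| "pvars (PImp \<phi> \<psi>) = pvars \<phi> \<union> pvars \<psi>"
| "pvars (PAll x \<phi>) = insert x (pvars \<phi>)"

fun psubst :: "nat \<Rightarrow> tm \<Rightarrow> pfm \<Rightarrow> pfm" where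
  "psubst x t (PEq r s) = PEq (subst_tm x t r) (subst_tm x t s)"
| "psubst x t (PRel q r s) = PRel (subst_tm x t q) (subst_tm x t r) (subst_tm x t s)"
| "psubst x t (PNeg \<phi>) = PNeg (psubst x t \<phi>)"
| "psubst x t (PImp \<phi> \<psi>) = PImp (psubst x t \<phi>) (psubst x t \<psi>)"
| "psubst x t (PAll y \<phi>) = (if y = x then PAll y \<phi> else PAll y (psubst x t \<phi>))"

fun pfree_for :: "tm \<Rightarrow> nat \<Rightarrow> pfm \<Rightarrow> bool" where
  "pfree_for t x (PEq r s) \<longleftrightarrow> True"
| "pfree_for t x (PRel q r s) \<longleftrightarrow> True"
| "pfree_for t x (PNeg \<phi>) \<longleftrightarrow> pfree_for t x \<phi>"
| "pfree_for t x (PImp \<phi> \<psi>) \<longleftrightarrow> pfree_for t x \<phi> \<and> pfree_for t x \<psi>"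
| "pfree_for t x (PAll y \<phi>) \<longleftrightarrow>
     x \<notin> pfree_vars (PAll y \<phi>) \<or> (y \<notin> vars_tm t \<and> pfree_for t x \<phi>)"

text \<open>The Hilbert calculus of the arithmetical language, extended to the new symbol. Keeping the same
  schemes makes every axiom go over to an axiom when a formula is substituted for \<open>PRel\<close>.\<close>

inductive prov :: "pfm \<Rightarrow> bool" where
  K: "prov (PImp \<phi> (PImp \<psi> \<phi>))"
| S: "prov (PImp (PImp \<phi> (PImp \<psi> \<chi>)) (PImp (PImp \<phi> \<psi>) (PImp \<phi> \<chi>)))"
| contra: "prov (PImp (PImp (PNeg \<phi>) (PNeg \<psi>)) (PImp \<psi> \<phi>))"
| inst: "pfree_for t x \<phi> \<Longrightarrow> prov (PImp (PAll x \<phi>) (psubst x t \<phi>))"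
| distr: "x \<notin> pfree_vars \<phi> \<Longrightarrow> prov (PImp (PAll x (PImp \<phi> \<psi>)) (PImp \<phi> (PAll x \<psi>)))"
| eq_refl: "prov (PEq t t)"
| eq_subst: "pfree_for s x \<phi> \<Longrightarrow> pfree_for t x \<phi> \<Longrightarrow>
     prov (PImp (PEq s t) (PImp (psubst x s \<phi>) (psubst x t \<phi>)))"
| mp: "prov (PImp \<phi> \<psi>) \<Longrightarrow> prov \<phi> \<Longrightarrow> prov \<psi>"
| gen: "prov \<phi> \<Longrightarrow> prov (PAll x \<phi>)"

fun val :: "'a \<Rightarrow> 'a \<Rightarrow> ('a \<Rightarrow> 'a \<Rightarrow> 'a) \<Rightarrow> (nat \<Rightarrow> 'a) \<Rightarrow> tm \<Rightarrow> 'a" where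
  "val z u f e (Var x) = e x"
| "val z u f e Zero = z"
| "val z u f e One = u"
| "val z u f e (Add s t) = f (val z u f e s) (val z u f e t)"

text \<open>Quantifiers range over a set \<open>D\<close> rather than over the whole type, because the universe of the
  canonical model below is a quotient of the terms and as such only a set of sets of terms.\<close>

fun psem :: "'a set \<Rightarrow> 'a \<Rightarrow> 'a \<Rightarrow> ('a \<Rightarrow> 'a \<Rightarrow> 'a) \<Rightarrow> ('a \<Rightarrow> 'a \<Rightarrow> 'a \<Rightarrow> bool) \<Rightarrow>
    (nat \<Rightarrow> 'a) \<Rightarrow> pfm \<Rightarrow> bool" where
  "psem D z u f R e (PEq s t) \<longleftrightarrow> val z u f e s = val z u f e t"
| "psem D z u f R e (PRel r s t) \<longleftrightarrow> R (val z u f e r) (val z u f e s) (val z u f e t)"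
| "psem D z u f R e (PNeg \<phi>) \<longleftrightarrow> \<not> psem D z u f R e \<phi>"
| "psem D z u f R e (PImp \<phi> \<psi>) \<longleftrightarrow> (psem D z u f R e \<phi> \<longrightarrow> psem D z u f R e \<psi>)"
| "psem D z u f R e (PAll x \<phi>) \<longleftrightarrow> (\<forall>d\<in>D. psem D z u f R (e(x := d)) \<phi>)"

lemma val_cong: "(\<And>x. x \<in> vars_tm t \<Longrightarrow> e x = e' x) \<Longrightarrow> val z u f e t = val z u f e' t"
  by (induction t) auto

lemma val_subst: "val z u f e (subst_tm x s t) = val z u f (e(x := val z u f e s)) t"
  by (induction t) auto

lemma subst_tm_absent: "x \<notin> vars_tm s \<Longrightarrow> subst_tm x t s = s"
  by (induction s) auto

lemma psem_cong: "(\<And>x. x \<in> pfree_vars \<phi> \<Longrightarrow> e x = e' x) \<Longrightarrow> psem D z u f R e \<phi> = psem D z u f R e' \<phi>"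
proof (induction \<phi> arbitrary: e e')
  case (PEq s t)
  then show ?case using val_cong[of s e e' z u f] val_cong[of t e e' z u f] by auto
next
  case (PRel r s t)
  then show ?case
    using val_cong[of r e e' z u f] val_cong[of s e e' z u f] val_cong[of t e e' z u f] by auto
next
  case (PNeg \<phi>)
  then show ?case by (metis pfree_vars.simps(3) psem.simps(3))
next
  case (PImp \<phi> \<psi>)
  have "psem D z u f R e \<phi> = psem D z u f R e' \<phi>" "psem D z u f R e \<psi> = psem D z u f R e' \<psi>"
    by (rule PImp.IH, simp add: PImp.prems)+
  then show ?case by simp
next
  case (PAll x \<phi>)
  have "psem D z u f R (e(x := d)) \<phi> = psem D z u f R (e'(x := d)) \<phi>" for d
    by (rule PAll.IH) (simp add: PAll.prems)
  then show ?case by simp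
qed

lemma psubst_absent: "x \<notin> pfree_vars \<phi> \<Longrightarrow> psubst x t \<phi> = \<phi>"
  by (induction \<phi>) (auto simp: subst_tm_absent)

lemma psem_subst:
  "pfree_for t x \<phi> \<Longrightarrow> psem D z u f R e (psubst x t \<phi>) = psem D z u f R (e(x := val z u f e t)) \<phi>"
proof (induction \<phi> arbitrary: e)
  case (PAll y \<phi>)
  show ?case
  proof (cases "x \<in> pfree_vars (PAll y \<phi>)")
    case False
    show ?thesis
      unfolding psubst_absent[OF False] by (rule psem_cong) (use False in auto)
  next
    case True
    with PAll.prems have y: "y \<notin> vars_tm t" "pfree_for t x \<phi>" by auto
    have "y \<noteq> x" using True by auto
    have "val z u f (e(y := d)) t = val z u f e t" for d
      by (rule val_cong) (use y in auto)
    then have "psem D z u f R (e(y := d)) (psubst x t \<phi>) =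
        psem D z u f R (e(x := val z u f e t, y := d)) \<phi>" for d
      using PAll.IH[OF y(2), of "e(y := d)"] fun_upd_twist[OF \<open>y \<noteq> x\<close>, of e] by metis
    then show ?thesis using \<open>y \<noteq> x\<close> by (simp add: fun_upd_def)
  qed
qed (auto simp: val_subst)

lemma finite_vars_tm: "finite (vars_tm t)"
  by (induction t) auto

lemma finite_pvars: "finite (pvars \<phi>)"
  by (induction \<phi>) (auto simp: finite_vars_tm)

lemma pfree_vars_subset: "pfree_vars \<phi> \<subseteq> pvars \<phi>"
  by (induction \<phi>) auto

lemma pfree_for_fresh: "vars_tm t \<inter> pvars \<phi> = {} \<Longrightarrow> pfree_for t x \<phi>"
  by (induction \<phi>) auto

section \<open>Completeness of the calculus\<close>

text \<open>Generalization is confined to theorems, so the deduction theorem holds without side condition;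
  generalization under hypotheses comes back as \<open>ded_gen\<close>.\<close>

inductive ded :: "pfm set \<Rightarrow> pfm \<Rightarrow> bool" for \<Gamma> where
  hyp: "\<phi> \<in> \<Gamma> \<Longrightarrow> ded \<Gamma> \<phi>"
| lift: "prov \<phi> \<Longrightarrow> ded \<Gamma> \<phi>"
| mp: "ded \<Gamma> (PImp \<phi> \<psi>) \<Longrightarrow> ded \<Gamma> \<phi> \<Longrightarrow> ded \<Gamma> \<psi>"

definition consistent :: "pfm set \<Rightarrow> bool" where
  "consistent \<Gamma> \<longleftrightarrow> \<not> (\<exists>\<phi>. ded \<Gamma> \<phi> \<and> ded \<Gamma> (PNeg \<phi>))"

lemma ded_mono: "ded \<Gamma> \<phi> \<Longrightarrow> \<Gamma> \<subseteq> \<Delta> \<Longrightarrow> ded \<Delta> \<phi>"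
  by (induction rule: ded.induct) (auto intro: ded.intros)

lemma ded_empty: "ded {} \<phi> \<Longrightarrow> prov \<phi>"
  by (induction rule: ded.induct) (auto intro: prov.mp)

lemma ded_finite: "ded \<Gamma> \<phi> \<Longrightarrow> \<exists>\<Delta>. finite \<Delta> \<and> \<Delta> \<subseteq> \<Gamma> \<and> ded \<Delta> \<phi>"
proof (induction rule: ded.induct)
  case (hyp \<phi>)
  then show ?case by (intro exI[of _ "{\<phi>}"]) (auto intro: ded.hyp)
next
  case (lift \<phi>)
  then show ?case by (intro exI[of _ "{}"]) (auto intro: ded.lift)
next
  case (mp \<phi> \<psi>)
  then obtain \<Delta>1 \<Delta>2 where "finite \<Delta>1" "\<Delta>1 \<subseteq> \<Gamma>" "ded \<Delta>1 (PImp \<phi> \<psi>)"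
    "finite \<Delta>2" "\<Delta>2 \<subseteq> \<Gamma>" "ded \<Delta>2 \<phi>" by blast
  then show ?case
    by (intro exI[of _ "\<Delta>1 \<union> \<Delta>2"]) (auto intro: ded.mp ded_mono)
qed

lemma ded_refl: "ded \<Gamma> (PImp \<phi> \<phi>)"
  using ded.mp[OF ded.mp[OF ded.lift[OF prov.S[of \<phi> "PImp \<phi> \<phi>" \<phi>]] ded.lift[OF prov.K]]
    ded.lift[OF prov.K]] .

lemma ded_weaken: "ded \<Gamma> \<phi> \<Longrightarrow> ded \<Gamma> (PImp \<psi> \<phi>)"
  by (rule ded.mp[OF ded.lift[OF prov.K]])

lemma deduction: "ded (insert \<phi> \<Gamma>) \<psi> \<Longrightarrow> ded \<Gamma> (PImp \<phi> \<psi>)"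
proof (induction rule: ded.induct)
  case (hyp \<psi>)
  then show ?case by (auto intro: ded_refl ded_weaken ded.hyp)
next
  case (lift \<psi>)
  then show ?case by (auto intro: ded_weaken ded.lift)
next
  case (mp \<psi> \<chi>)
  show ?case by (rule ded.mp[OF ded.mp[OF ded.lift[OF prov.S] mp.IH(1)] mp.IH(2)])
qed

lemma explosion: "ded \<Gamma> \<phi> \<Longrightarrow> ded \<Gamma> (PNeg \<phi>) \<Longrightarrow> ded \<Gamma> \<psi>"
  by (rule ded.mp[OF ded.mp[OF ded.lift[OF prov.contra[of \<psi> \<phi>]] ded_weaken]])

text \<open>Classical reasoning enters through the contraposition axiom: an inconsistent set derives, in
  particular, the negation of a theorem.\<close>

lemma ded_by_contradiction: "\<not> consistent (insert (PNeg \<phi>) \<Gamma>) \<Longrightarrow> ded \<Gamma> \<phi>"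
proof -
  assume "\<not> consistent (insert (PNeg \<phi>) \<Gamma>)"
  then have "ded (insert (PNeg \<phi>) \<Gamma>) (PNeg (PImp \<phi> \<phi>))"
    unfolding consistent_def by (blast intro: explosion)
  from ded.mp[OF ded.mp[OF ded.lift[OF prov.contra] deduction[OF this]] ded_refl]
  show ?thesis .
qed

lemma ded_neg: assumes "\<not> consistent (insert \<phi> \<Gamma>)" shows "ded \<Gamma> (PNeg \<phi>)"
proof -
  have "ded (insert (PNeg (PNeg \<phi>)) \<Gamma>) \<phi>"
  proof (rule ded_by_contradiction)
    show "\<not> consistent (insert (PNeg \<phi>) (insert (PNeg (PNeg \<phi>)) \<Gamma>))"
      unfolding consistent_def not_not by (intro exI[of _ "PNeg \<phi>"] conjI ded.hyp) auto
  qed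
  moreover from assms obtain \<psi> where "ded \<Gamma> (PImp \<phi> \<psi>)" "ded \<Gamma> (PImp \<phi> (PNeg \<psi>))"
    unfolding consistent_def using deduction by blast
  ultimately have "ded (insert (PNeg (PNeg \<phi>)) \<Gamma>) \<psi>" "ded (insert (PNeg (PNeg \<phi>)) \<Gamma>) (PNeg \<psi>)"
    using ded.mp[OF ded_mono[OF _ subset_insertI]] by blast+
  then have "\<not> consistent (insert (PNeg (PNeg \<phi>)) \<Gamma>)"
    unfolding consistent_def by blast
  then show ?thesis by (rule ded_by_contradiction)
qed

lemma ded_all_imps:
  "ded \<Gamma> (PAll x (foldr PImp \<phi>s \<psi>)) \<Longrightarrow> set \<phi>s \<subseteq> \<Gamma> \<Longrightarrow> x \<notin> (\<Union>\<phi>\<in>\<Gamma>. pfree_vars \<phi>) \<Longrightarrow>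
    ded \<Gamma> (PAll x \<psi>)"
proof (induction \<phi>s)
  case (Cons \<phi> \<phi>s)
  have "ded \<Gamma> (PImp \<phi> (PAll x (foldr PImp \<phi>s \<psi>)))"
    using Cons.prems by (intro ded.mp[OF ded.lift[OF prov.distr]]) auto
  then have "ded \<Gamma> (PAll x (foldr PImp \<phi>s \<psi>))"
    by (rule ded.mp) (use Cons.prems in \<open>auto intro: ded.hyp\<close>)
  then show ?case using Cons by simp
qed simp

lemma ded_imps: "ded (set \<phi>s \<union> \<Gamma>) \<psi> \<Longrightarrow> ded \<Gamma> (foldr PImp \<phi>s \<psi>)"
proof (induction \<phi>s arbitrary: \<Gamma>)
  case (Cons \<phi> \<phi>s)
  then have "ded (insert \<phi> \<Gamma>) (foldr PImp \<phi>s \<psi>)" by (intro Cons.IH) simp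
  then show ?case by (simp add: deduction)
qed simp

text \<open>Only finitely many hypotheses are used. They are discharged, the resulting theorem is generalized,
  and the quantifier is then pushed past the hypotheses again.\<close>

lemma ded_gen:
  assumes "ded \<Gamma> \<psi>" "x \<notin> (\<Union>\<phi>\<in>\<Gamma>. pfree_vars \<phi>)"
  shows "ded \<Gamma> (PAll x \<psi>)"
proof -
  from ded_finite[OF assms(1)] obtain \<Delta> where \<Delta>: "finite \<Delta>" "\<Delta> \<subseteq> \<Gamma>" "ded \<Delta> \<psi>" by blast
  from finite_list[OF \<Delta>(1)] obtain \<phi>s where \<phi>s: "set \<phi>s = \<Delta>" by blast
  have "ded {} (foldr PImp \<phi>s \<psi>)" by (rule ded_imps) (use \<Delta> \<phi>s in auto)
  then have "ded \<Gamma> (PAll x (foldr PImp \<phi>s \<psi>))"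
    using ded.lift[OF prov.gen[OF ded_empty]] by blast
  then show ?thesis by (rule ded_all_imps) (use \<Delta> \<phi>s assms(2) in auto)
qed

lemma subst_tm_back: "y \<notin> vars_tm s \<Longrightarrow> subst_tm y (Var x) (subst_tm x (Var y) s) = s"
  by (induction s) auto

lemma psubst_back: "y \<notin> pvars \<phi> \<Longrightarrow> psubst y (Var x) (psubst x (Var y) \<phi>) = \<phi>"
  by (induction \<phi>) (auto simp: subst_tm_back psubst_absent contra_subsetD[OF pfree_vars_subset])

lemma vars_subst_tm: "vars_tm (subst_tm x t s) \<subseteq> (vars_tm s - {x}) \<union> vars_tm t"
  by (induction s) auto

lemma pfree_vars_psubst: "pfree_vars (psubst x t \<phi>) \<subseteq> (pfree_vars \<phi> - {x}) \<union> vars_tm t"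
proof (induction \<phi>)
  case (PEq r s)
  then show ?case using vars_subst_tm[of x t r] vars_subst_tm[of x t s] by auto
next
  case (PRel q r s)
  then show ?case
    using vars_subst_tm[of x t q] vars_subst_tm[of x t r] vars_subst_tm[of x t s] by auto
qed auto

lemma pfree_for_back: "y \<notin> pvars \<phi> \<Longrightarrow> pfree_for (Var x) y (psubst x (Var y) \<phi>)"
  by (induction \<phi>) (auto dest: subsetD[OF pfree_vars_subset])

text \<open>If the witness \<open>y\<close> led to a contradiction, the hypotheses, in which \<open>y\<close> does not occur, would derive
  the instance at \<open>y\<close>, hence its generalization, and that is the quantified formula up to renaming.\<close>

lemma consistent_witness:
  assumes con: "consistent (insert (PNeg (PAll x \<psi>)) \<Gamma>)"
    and y: "y \<notin> pvars (PAll x \<psi>)" "y \<notin> (\<Union>\<phi>\<in>\<Gamma>. pvars \<phi>)"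
  shows "consistent (insert (PNeg (psubst x (Var y) \<psi>)) (insert (PNeg (PAll x \<psi>)) \<Gamma>))"
proof (rule ccontr)
  let ?\<Gamma> = "insert (PNeg (PAll x \<psi>)) \<Gamma>" and ?\<psi> = "psubst x (Var y) \<psi>"
  assume "\<not> consistent (insert (PNeg ?\<psi>) ?\<Gamma>)"
  then have "ded ?\<Gamma> ?\<psi>" by (rule ded_by_contradiction)
  then have *: "ded ?\<Gamma> (PAll y ?\<psi>)"
    by (rule ded_gen) (use y pfree_vars_subset in fastforce)
  have "prov (PImp (PAll y ?\<psi>) \<psi>)"
    using prov.inst[OF pfree_for_back[of y \<psi> x]] y psubst_back[of y \<psi> x] by simp
  moreover have "x \<notin> pfree_vars (PAll y ?\<psi>)"
    using pfree_vars_psubst[of x "Var y" \<psi>] y by auto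
  ultimately have "prov (PImp (PAll y ?\<psi>) (PAll x \<psi>))"
    by (intro prov.mp[OF prov.distr] prov.gen)
  from ded.mp[OF ded.lift[OF this] *] have "ded ?\<Gamma> (PAll x \<psi>)" .
  moreover have "ded ?\<Gamma> (PNeg (PAll x \<psi>))" by (simp add: ded.hyp)
  ultimately show False using con unfolding consistent_def by blast
qed

instance tm :: countable by countable_datatype
instance pfm :: countable by countable_datatype

text \<open>Variables serve as witnesses in place of new constants. At each stage only finitely many
  variables are in use. The bound \<open>n\<close> makes the witnesses of later stages avoid any given finite set.\<close>

definition fresh :: "nat \<Rightarrow> pfm set \<Rightarrow> nat" where
  "fresh n \<Gamma> = (SOME y. n \<le> y \<and> y \<notin> (\<Union>\<phi>\<in>\<Gamma>. pvars \<phi>))"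

text \<open>An enumeration in which each formula recurs infinitely often; hence each false universal
  statement acquires infinitely many witnesses.\<close>

definition nth_formula :: "nat \<Rightarrow> pfm" where
  "nth_formula n = from_nat (fst (prod_decode n))"

fun with_witness :: "nat \<Rightarrow> pfm \<Rightarrow> pfm set \<Rightarrow> pfm set" where
  "with_witness n (PNeg (PAll x \<psi>)) \<Gamma> =
     insert (PNeg (psubst x (Var (fresh n (insert (PNeg (PAll x \<psi>)) \<Gamma>))) \<psi>))
       (insert (PNeg (PAll x \<psi>)) \<Gamma>)"
| "with_witness n \<phi> \<Gamma> = insert \<phi> \<Gamma>"

primrec henkin :: "pfm set \<Rightarrow> nat \<Rightarrow> pfm set" where
  "henkin \<Gamma> 0 = \<Gamma>"
| "henkin \<Gamma> (Suc n) =
    (if consistent (insert (nth_formula n) (henkin \<Gamma> n))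
     then with_witness n (nth_formula n) (henkin \<Gamma> n) else henkin \<Gamma> n)"

lemma fresh: assumes "finite \<Gamma>"
  shows "n \<le> fresh n \<Gamma>" "fresh n \<Gamma> \<notin> (\<Union>\<phi>\<in>\<Gamma>. pvars \<phi>)"
proof -
  have "finite ({..<n} \<union> (\<Union>\<phi>\<in>\<Gamma>. pvars \<phi>))" using assms finite_pvars by auto
  then obtain y where "y \<notin> {..<n} \<union> (\<Union>\<phi>\<in>\<Gamma>. pvars \<phi>)"
    using ex_new_if_finite[OF infinite_UNIV_nat] by blast
  then have "n \<le> y \<and> y \<notin> (\<Union>\<phi>\<in>\<Gamma>. pvars \<phi>)" by auto
  then have "n \<le> fresh n \<Gamma> \<and> fresh n \<Gamma> \<notin> (\<Union>\<phi>\<in>\<Gamma>. pvars \<phi>)" unfolding fresh_def by (rule someI)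
  then show "n \<le> fresh n \<Gamma>" "fresh n \<Gamma> \<notin> (\<Union>\<phi>\<in>\<Gamma>. pvars \<phi>)" by auto
qed

lemma with_witness_finite: "finite \<Gamma> \<Longrightarrow> finite (with_witness n \<phi> \<Gamma>)"
  by (cases "(n, \<phi>, \<Gamma>)" rule: with_witness.cases) auto

lemma with_witness_superset: "insert \<phi> \<Gamma> \<subseteq> with_witness n \<phi> \<Gamma>"
  by (cases "(n, \<phi>, \<Gamma>)" rule: with_witness.cases) auto

lemma with_witness_consistent:
  assumes "finite \<Gamma>" "consistent (insert \<phi> \<Gamma>)"
  shows "consistent (with_witness n \<phi> \<Gamma>)"
proof (cases "\<exists>x \<psi>. \<phi> = PNeg (PAll x \<psi>)")
  case True
  then obtain x \<psi> where "\<phi> = PNeg (PAll x \<psi>)" by blast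
  moreover have "fresh n (insert \<phi> \<Gamma>) \<notin> (\<Union>\<phi>\<in>insert \<phi> \<Gamma>. pvars \<phi>)"
    using fresh(2)[of "insert \<phi> \<Gamma>" n] assms(1) by auto
  ultimately show ?thesis
    using consistent_witness[of x \<psi> \<Gamma> "fresh n (insert \<phi> \<Gamma>)"] assms(2) by auto
next
  case False
  then have "with_witness n \<phi> \<Gamma> = insert \<phi> \<Gamma>"
    by (cases "(n, \<phi>, \<Gamma>)" rule: with_witness.cases) auto
  then show ?thesis using assms(2) by simp
qed

lemma nth_formula_cofinal: "\<exists>n\<ge>m. nth_formula n = \<phi>"
  by (intro exI[of _ "prod_encode (to_nat \<phi>, m)"])
    (auto simp: nth_formula_def le_prod_encode_2)

text \<open>The conditions under which the terms modulo provable equality form a model. Witnesses are demanded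
  outside of any finite set, since a variable that does not occur in a formula can be substituted into
  it without capture.\<close>

locale henkin_set =
  fixes \<Gamma> :: "pfm set"
  assumes con: "consistent \<Gamma>"
    and dec: "\<phi> \<in> \<Gamma> \<or> PNeg \<phi> \<in> \<Gamma>"
    and wit: "PNeg (PAll x \<psi>) \<in> \<Gamma> \<Longrightarrow> finite V \<Longrightarrow>
      \<exists>y. y \<notin> V \<and> y \<notin> pvars \<psi> \<and> PNeg (psubst x (Var y) \<psi>) \<in> \<Gamma>"
begin

lemma closed: "ded \<Gamma> \<phi> \<Longrightarrow> \<phi> \<in> \<Gamma>"
  using con dec[of \<phi>] ded.hyp[of "PNeg \<phi>" \<Gamma>] unfolding consistent_def by blast

lemma prov_in: "prov \<phi> \<Longrightarrow> \<phi> \<in> \<Gamma>"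
  by (rule closed) (rule ded.lift)

lemma mp_in: "PImp \<phi> \<psi> \<in> \<Gamma> \<Longrightarrow> \<phi> \<in> \<Gamma> \<Longrightarrow> \<psi> \<in> \<Gamma>"
  by (rule closed[OF ded.mp[OF ded.hyp ded.hyp]])

lemma neg_iff: "PNeg \<phi> \<in> \<Gamma> \<longleftrightarrow> \<phi> \<notin> \<Gamma>"
  using con dec[of \<phi>] ded.hyp[of _ \<Gamma>] unfolding consistent_def by blast

lemma imp_iff: "PImp \<phi> \<psi> \<in> \<Gamma> \<longleftrightarrow> (\<phi> \<in> \<Gamma> \<longrightarrow> \<psi> \<in> \<Gamma>)"
proof
  assume "PImp \<phi> \<psi> \<in> \<Gamma>" then show "\<phi> \<in> \<Gamma> \<longrightarrow> \<psi> \<in> \<Gamma>" using mp_in by blast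
next
  assume *: "\<phi> \<in> \<Gamma> \<longrightarrow> \<psi> \<in> \<Gamma>"
  show "PImp \<phi> \<psi> \<in> \<Gamma>"
  proof (cases "\<phi> \<in> \<Gamma>")
    case True
    with * show ?thesis using mp_in[OF prov_in[OF prov.K]] by blast
  next
    case False
    then have "PNeg \<phi> \<in> \<Gamma>" by (simp add: neg_iff)
    then have "ded (insert \<phi> \<Gamma>) \<psi>"
      by (intro explosion[OF ded.hyp[of \<phi>] ded.hyp]) auto
    then show ?thesis by (intro closed deduction)
  qed
qed

lemma eq_subst_in:
  assumes "PEq s t \<in> \<Gamma>" "psubst x s \<phi> \<in> \<Gamma>" "pfree_for s x \<phi>" "pfree_for t x \<phi>"
  shows "psubst x t \<phi> \<in> \<Gamma>"
  using mp_in[OF mp_in[OF prov_in[OF prov.eq_subst]]] assms by blast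

lemma ex_fresh: "finite V \<Longrightarrow> \<exists>x::nat. x \<notin> V"
  by (rule ex_new_if_finite[OF infinite_UNIV_nat])

lemma eq_sym: assumes "PEq s t \<in> \<Gamma>" shows "PEq t s \<in> \<Gamma>"
proof -
  obtain x where x: "x \<notin> vars_tm s" using ex_fresh finite_vars_tm by blast
  show ?thesis
    using eq_subst_in[OF assms, of x "PEq (Var x) s"] prov_in[OF prov.eq_refl[of s]] x
    by (simp add: subst_tm_absent)
qed

lemma eq_trans: assumes "PEq r s \<in> \<Gamma>" "PEq s t \<in> \<Gamma>" shows "PEq r t \<in> \<Gamma>"
proof -
  obtain x where x: "x \<notin> vars_tm r" using ex_fresh finite_vars_tm by blast
  show ?thesis
    using eq_subst_in[OF assms(2), of x "PEq r (Var x)"] assms(1) x by (simp add: subst_tm_absent)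
qed

lemma eq_add: assumes "PEq s s' \<in> \<Gamma>" "PEq t t' \<in> \<Gamma>" shows "PEq (Add s t) (Add s' t') \<in> \<Gamma>"
proof -
  obtain x where x: "x \<notin> vars_tm s \<union> vars_tm t \<union> vars_tm s' \<union> vars_tm t'"
    using ex_fresh finite_vars_tm by (metis finite_UnI)
  have "PEq (Add s t) (Add s' t) \<in> \<Gamma>"
    using eq_subst_in[OF assms(1), of x "PEq (Add s t) (Add (Var x) t)"]
      prov_in[OF prov.eq_refl[of "Add s t"]] x by (simp add: subst_tm_absent)
  then show ?thesis
    using eq_subst_in[OF assms(2), of x "PEq (Add s t) (Add s' (Var x))"] x
    by (simp add: subst_tm_absent)
qed

lemma rel_cong:
  assumes "PEq r r' \<in> \<Gamma>" "PEq s s' \<in> \<Gamma>" "PEq t t' \<in> \<Gamma>" "PRel r s t \<in> \<Gamma>"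
  shows "PRel r' s' t' \<in> \<Gamma>"
proof -
  obtain x where x: "x \<notin> vars_tm s \<union> vars_tm t \<union> vars_tm r \<union> vars_tm s' \<union> vars_tm t' \<union> vars_tm r'"
    using ex_fresh finite_vars_tm by (metis finite_UnI)
  have "PRel r' s t \<in> \<Gamma>"
    using eq_subst_in[OF assms(1), of x "PRel (Var x) s t"] assms(4) x by (simp add: subst_tm_absent)
  then have "PRel r' s' t \<in> \<Gamma>"
    using eq_subst_in[OF assms(2), of x "PRel r' (Var x) t"] x by (simp add: subst_tm_absent)
  then show ?thesis
    using eq_subst_in[OF assms(3), of x "PRel r' s' (Var x)"] x by (simp add: subst_tm_absent)
qed

definition cls :: "tm \<Rightarrow> tm set" where
  "cls t = {s. PEq t s \<in> \<Gamma>}"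

text \<open>The operations are defined through chosen representatives; congruence of provable equality makes
  the choice immaterial.\<close>

definition cls_add :: "tm set \<Rightarrow> tm set \<Rightarrow> tm set" where
  "cls_add X Y = cls (Add (SOME s. X = cls s) (SOME t. Y = cls t))"

definition cls_rel :: "tm set \<Rightarrow> tm set \<Rightarrow> tm set \<Rightarrow> bool" where
  "cls_rel X Y Z \<longleftrightarrow> PRel (SOME r. X = cls r) (SOME s. Y = cls s) (SOME t. Z = cls t) \<in> \<Gamma>"

lemma cls_eq_iff: "cls s = cls t \<longleftrightarrow> PEq s t \<in> \<Gamma>"
  unfolding cls_def using eq_sym eq_trans prov_in[OF prov.eq_refl] by blast

lemma cls_some: "PEq (SOME s. cls t = cls s) t \<in> \<Gamma>"
  using someI[of "\<lambda>s. cls t = cls s" t] cls_eq_iff by blast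

lemma cls_add_cls: "cls_add (cls s) (cls t) = cls (Add s t)"
  unfolding cls_add_def using iffD2[OF cls_eq_iff eq_add[OF cls_some cls_some]] .

lemma cls_rel_cls: "cls_rel (cls r) (cls s) (cls t) \<longleftrightarrow> PRel r s t \<in> \<Gamma>"
  unfolding cls_rel_def using rel_cong eq_sym cls_some by blast

text \<open>A witness of \<open>\<exists>x. x = t\<close> is a variable in the class of \<open>t\<close>. Thus every element of the model is named by
  variables that are foreign to the formula under consideration.\<close>

lemma cls_variable: assumes "finite V" shows "\<exists>y. y \<notin> V \<and> cls t = cls (Var y)"
proof -
  obtain x where x: "x \<notin> vars_tm t" using ex_fresh finite_vars_tm by blast
  have "PAll x (PNeg (PEq (Var x) t)) \<notin> \<Gamma>"
  proof
    assume "PAll x (PNeg (PEq (Var x) t)) \<in> \<Gamma>"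
    then have "PNeg (PEq t t) \<in> \<Gamma>"
      using mp_in[OF prov_in[OF prov.inst[of t x "PNeg (PEq (Var x) t)"]]] x
      by (simp add: subst_tm_absent)
    then show False using neg_iff prov_in[OF prov.eq_refl] by blast
  qed
  then have "PNeg (PAll x (PNeg (PEq (Var x) t))) \<in> \<Gamma>" by (simp add: neg_iff)
  from wit[OF this assms] obtain y where "y \<notin> V" "PNeg (PNeg (PEq (Var y) t)) \<in> \<Gamma>"
    using x by (auto simp: subst_tm_absent)
  then show ?thesis using neg_iff cls_eq_iff by blast
qed

lemma val_cls: "val (cls Zero) (cls One) cls_add (\<lambda>x. cls (Var x)) t = cls t"
  by (induction t) (auto simp: cls_add_cls)

lemma size_psubst_Var: "size (psubst x (Var y) \<phi>) = size \<phi>"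
  by (induction \<phi>) auto

text \<open>The induction is on the size of the formula, because the induction hypothesis for a universal
  formula is needed for its instances at variables.\<close>

lemma truth: "psem (range cls) (cls Zero) (cls One) cls_add cls_rel (\<lambda>x. cls (Var x)) \<phi> \<longleftrightarrow> \<phi> \<in> \<Gamma>"
proof (induction "size \<phi>" arbitrary: \<phi> rule: less_induct)
  case less
  let ?sem = "psem (range cls) (cls Zero) (cls One) cls_add cls_rel"
  let ?e = "\<lambda>x. cls (Var x)"
  show ?case
  proof (cases \<phi>)
    case (PAll x \<psi>)
    have IH: "?sem (?e(x := cls (Var y))) \<psi> \<longleftrightarrow> psubst x (Var y) \<psi> \<in> \<Gamma>" if "y \<notin> pvars \<psi>" for y
      using less[of "psubst x (Var y) \<psi>"] that PAll
      by (simp add: size_psubst_Var psem_subst pfree_for_fresh)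
    show ?thesis
    proof
      assume sem: "?sem ?e \<phi>"
      show "\<phi> \<in> \<Gamma>"
      proof (rule ccontr)
        assume "\<phi> \<notin> \<Gamma>"
        then obtain y where "y \<notin> pvars \<psi>" "PNeg (psubst x (Var y) \<psi>) \<in> \<Gamma>"
          using wit[of x \<psi> "{}"] PAll neg_iff by auto
        then show False using IH sem PAll neg_iff by auto
      qed
    next
      assume \<phi>: "\<phi> \<in> \<Gamma>"
      have "?sem (?e(x := cls t)) \<psi>" for t
      proof -
        obtain y where y: "y \<notin> pvars \<psi>" "cls t = cls (Var y)"
          using cls_variable[OF finite_pvars] by blast
        have "psubst x (Var y) \<psi> \<in> \<Gamma>"
          using mp_in[OF prov_in[OF prov.inst[of "Var y" x \<psi>]]] \<phi> PAll y by (simp add: pfree_for_fresh)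
        then show ?thesis using IH y by simp
      qed
      then show "?sem ?e \<phi>" using PAll by auto
    qed
  qed (auto simp: val_cls cls_eq_iff cls_rel_cls neg_iff imp_iff less)
qed

end

lemma henkin_finite: "finite \<Gamma> \<Longrightarrow> finite (henkin \<Gamma> n)"
  by (induction n) (auto simp: with_witness_finite)

lemma henkin_consistent: "finite \<Gamma> \<Longrightarrow> consistent \<Gamma> \<Longrightarrow> consistent (henkin \<Gamma> n)"
  by (induction n) (auto simp: with_witness_consistent henkin_finite)

lemma henkin_mono: "m \<le> n \<Longrightarrow> henkin \<Gamma> m \<subseteq> henkin \<Gamma> n"
proof (rule lift_Suc_mono_le[of "henkin \<Gamma>"])
  show "henkin \<Gamma> n \<subseteq> henkin \<Gamma> (Suc n)" for n
    using with_witness_superset by auto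
qed

lemma finite_subset_henkin: "finite \<Delta> \<Longrightarrow> \<Delta> \<subseteq> (\<Union>n. henkin \<Gamma> n) \<Longrightarrow> \<exists>n. \<Delta> \<subseteq> henkin \<Gamma> n"
proof (induction rule: finite_induct)
  case (insert \<phi> \<Delta>)
  then obtain m n where "\<phi> \<in> henkin \<Gamma> m" "\<Delta> \<subseteq> henkin \<Gamma> n" by auto
  then show ?case
    using henkin_mono[of m "max m n" \<Gamma>] henkin_mono[of n "max m n" \<Gamma>]
    by (intro exI[of _ "max m n"]) auto
qed simp

lemma henkin_set_henkin:
  assumes "finite \<Gamma>" "consistent \<Gamma>"
  shows "henkin_set (\<Union>n. henkin \<Gamma> n)"
proof
  let ?H = "\<Union>n. henkin \<Gamma> n"
  show con: "consistent ?H"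
  proof (rule ccontr)
    assume "\<not> consistent ?H"
    then obtain \<phi> where \<phi>: "ded ?H \<phi>" "ded ?H (PNeg \<phi>)" unfolding consistent_def by blast
    obtain \<Delta>1 \<Delta>2 where \<Delta>: "finite \<Delta>1" "\<Delta>1 \<subseteq> ?H" "ded \<Delta>1 \<phi>" "finite \<Delta>2" "\<Delta>2 \<subseteq> ?H" "ded \<Delta>2 (PNeg \<phi>)"
      using ded_finite[OF \<phi>(1)] ded_finite[OF \<phi>(2)] by blast
    then obtain n where "\<Delta>1 \<union> \<Delta>2 \<subseteq> henkin \<Gamma> n"
      using finite_subset_henkin[of "\<Delta>1 \<union> \<Delta>2" \<Gamma>] by blast
    with \<Delta> have "ded (henkin \<Gamma> n) \<phi>" "ded (henkin \<Gamma> n) (PNeg \<phi>)" by (auto intro: ded_mono)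
    then show False using henkin_consistent[OF assms] unfolding consistent_def by blast
  qed
  have added: "with_witness n \<phi> (henkin \<Gamma> n) \<subseteq> ?H"
    if "nth_formula n = \<phi>" "consistent (insert \<phi> (henkin \<Gamma> n))" for n \<phi>
  proof -
    have "with_witness n \<phi> (henkin \<Gamma> n) \<subseteq> henkin \<Gamma> (Suc n)" using that by simp
    then show ?thesis by blast
  qed
  have closed: "\<phi> \<in> ?H" if "ded ?H \<phi>" for \<phi>
  proof -
    obtain n where n: "nth_formula n = \<phi>" using nth_formula_cofinal by blast
    have "consistent (insert \<phi> (henkin \<Gamma> n))"
    proof (rule ccontr)
      assume "\<not> ?thesis"
      then have "ded (henkin \<Gamma> n) (PNeg \<phi>)" by (rule ded_neg)
      then have "ded ?H (PNeg \<phi>)" by (rule ded_mono) blast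
      with that con show False unfolding consistent_def by blast
    qed
    from subset_trans[OF with_witness_superset added[OF n this]] show ?thesis by simp
  qed
  show "\<phi> \<in> ?H \<or> PNeg \<phi> \<in> ?H" for \<phi>
  proof -
    obtain n where n: "nth_formula n = \<phi>" using nth_formula_cofinal by blast
    show ?thesis
    proof (cases "consistent (insert \<phi> (henkin \<Gamma> n))")
      case True
      from subset_trans[OF with_witness_superset added[OF n True]] show ?thesis by simp
    next
      case False
      then have "ded (henkin \<Gamma> n) (PNeg \<phi>)" by (rule ded_neg)
      then have "ded ?H (PNeg \<phi>)" by (rule ded_mono) blast
      then show ?thesis using closed by blast
    qed
  qed
  show "\<exists>y. y \<notin> V \<and> y \<notin> pvars \<psi> \<and> PNeg (psubst x (Var y) \<psi>) \<in> ?H"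
    if \<chi>: "PNeg (PAll x \<psi>) \<in> ?H" and V: "finite V" for x \<psi> V
  proof -
    let ?\<chi> = "PNeg (PAll x \<psi>)"
    obtain m where m: "V \<subseteq> {..<m}" using V finite_nat_iff_bounded by blast
    obtain n where n: "n \<ge> m" "nth_formula n = ?\<chi>" using nth_formula_cofinal by blast
    let ?\<Delta> = "insert ?\<chi> (henkin \<Gamma> n)" and ?y = "fresh n (insert ?\<chi> (henkin \<Gamma> n))"
    have "ded ?H \<phi>" if "ded ?\<Delta> \<phi>" for \<phi>
      by (rule ded_mono[OF that]) (use \<chi> in blast)
    with con have "consistent ?\<Delta>" unfolding consistent_def by blast
    from added[OF n(2) this] have "PNeg (psubst x (Var ?y) \<psi>) \<in> ?H" by simp
    moreover have "n \<le> ?y" "?y \<notin> (\<Union>\<phi>\<in>?\<Delta>. pvars \<phi>)"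
      using fresh[of ?\<Delta> n] henkin_finite[OF assms(1)] by auto
    ultimately show ?thesis using m n(1) by (intro exI[of _ ?y]) auto
  qed
qed

text \<open>The canonical model of a Henkin set that contains the negation of an underivable formula refutes
  that formula.\<close>

theorem completeness:
  assumes valid: "\<And>(D :: tm set set) z u f R e. z \<in> D \<Longrightarrow> u \<in> D \<Longrightarrow>
      (\<And>a b. a \<in> D \<Longrightarrow> b \<in> D \<Longrightarrow> f a b \<in> D) \<Longrightarrow> (\<And>x. e x \<in> D) \<Longrightarrow> psem D z u f R e \<phi>"
  shows "prov \<phi>"
proof (rule ccontr)
  assume "\<not> prov \<phi>"
  then have "\<not> ded {} \<phi>" using ded_empty by blast
  then have "consistent {PNeg \<phi>}" using ded_by_contradiction by blast
  then interpret H: henkin_set "\<Union>n. henkin {PNeg \<phi>} n" by (intro henkin_set_henkin) auto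
  have "psem (range H.cls) (H.cls Zero) (H.cls One) H.cls_add H.cls_rel (\<lambda>x. H.cls (Var x)) \<phi>"
    by (rule valid) (auto simp: H.cls_add_cls)
  then have "\<phi> \<in> (\<Union>n. henkin {PNeg \<phi>} n)" by (simp add: H.truth)
  moreover have "PNeg \<phi> \<in> (\<Union>n. henkin {PNeg \<phi>} n)"
  proof -
    have "PNeg \<phi> \<in> henkin {PNeg \<phi>} 0" by simp
    then show ?thesis by blast
  qed
  ultimately show False using H.neg_iff by blast
qed

section \<open>Substituting a formula for the relation symbol\<close>

fun bound_vars :: "fm \<Rightarrow> nat set" where
  "bound_vars (Eq s t) = {}"
| "bound_vars (Neg \<phi>) = bound_vars \<phi>"
| "bound_vars (Imp \<phi> \<psi>) = bound_vars \<phi> \<union> bound_vars \<psi>"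
| "bound_vars (Forall x \<phi>) = insert x (bound_vars \<phi>)"

fun shift :: "nat \<Rightarrow> tm \<Rightarrow> tm" where
  "shift k (Var x) = Var (x + k)"
| "shift k Zero = Zero"
| "shift k One = One"
| "shift k (Add s t) = Add (shift k s) (shift k t)"

text \<open>All variables are shifted by \<open>k\<close>, out of the way of the variables below \<open>k\<close> that are bound in the
  formula \<open>M\<close> put in place of the relation symbol. One derivation then serves for formulas \<open>M\<close> with ever
  more bound variables.\<close>

fun tr :: "nat \<Rightarrow> (tm \<Rightarrow> tm \<Rightarrow> tm \<Rightarrow> fm) \<Rightarrow> pfm \<Rightarrow> fm" where
  "tr k M (PEq s t) = Eq (shift k s) (shift k t)"
| "tr k M (PRel r s t) = M (shift k r) (shift k s) (shift k t)"
| "tr k M (PNeg \<phi>) = Neg (tr k M \<phi>)"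
| "tr k M (PImp \<phi> \<psi>) = Imp (tr k M \<phi>) (tr k M \<psi>)"
| "tr k M (PAll x \<phi>) = Forall (x + k) (tr k M \<phi>)"

abbreviation tm_length :: "tm \<Rightarrow> nat" where
  "tm_length t \<equiv> length (write_tm t)"

text \<open>What makes \<open>M\<close> behave like an atomic formula on terms with variables from \<open>k\<close> on: there is no
  capture and substitution acts on the arguments. The number \<open>w\<close> measures the size of \<open>M\<close> and, by the
  first condition, also the length of a shifted variable.\<close>

definition admissible :: "nat \<Rightarrow> nat \<Rightarrow> (tm \<Rightarrow> tm \<Rightarrow> tm \<Rightarrow> fm) \<Rightarrow> bool" where
  "admissible k w M \<longleftrightarrow> k + 1 \<le> w \<and>
     (\<forall>r s t. bound_vars (M r s t) \<subseteq> {..<k}) \<and>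
     (\<forall>r s t. vars_tm r \<union> vars_tm s \<union> vars_tm t \<subseteq> {k..} \<longrightarrow>
        free_vars (M r s t) \<subseteq> vars_tm r \<union> vars_tm s \<union> vars_tm t) \<and>
     (\<forall>x\<ge>k. \<forall>q r s t. subst x q (M r s t) = M (subst_tm x q r) (subst_tm x q s) (subst_tm x q t)) \<and>
     (\<forall>r s t. fm_length (M r s t) \<le> w * (tm_length r + tm_length s + tm_length t))"

lemma vars_shift: "vars_tm (shift k t) = (\<lambda>x. x + k) ` vars_tm t"
  by (induction t) auto

lemma shift_subst: "subst_tm (x + k) (shift k t) (shift k s) = shift k (subst_tm x t s)"
  by (induction s) auto

lemma free_for_bound: "bound_vars \<phi> \<inter> vars_tm t = {} \<Longrightarrow> free_for t x \<phi>"
  by (induction \<phi>) auto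

lemma free_vars_tr: "admissible k w M \<Longrightarrow> free_vars (tr k M \<phi>) \<subseteq> (\<lambda>x. x + k) ` pfree_vars \<phi>"
proof (induction \<phi>)
  case (PRel r s t)
  have "vars_tm (shift k r) \<union> vars_tm (shift k s) \<union> vars_tm (shift k t) \<subseteq> {k..}"
    by (auto simp: vars_shift)
  then have "free_vars (M (shift k r) (shift k s) (shift k t))
      \<subseteq> vars_tm (shift k r) \<union> vars_tm (shift k s) \<union> vars_tm (shift k t)"
    using PRel unfolding admissible_def by blast
  then show ?case by (auto simp: vars_shift)
qed (auto simp: vars_shift)

lemma tr_psubst: "admissible k w M \<Longrightarrow>
    tr k M (psubst x t \<phi>) = subst (x + k) (shift k t) (tr k M \<phi>)"
  by (induction \<phi>) (auto simp: shift_subst admissible_def)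

lemma free_for_tr: "admissible k w M \<Longrightarrow> pfree_for t x \<phi> \<Longrightarrow> free_for (shift k t) (x + k) (tr k M \<phi>)"
proof (induction \<phi>)
  case (PRel q r s)
  then have "bound_vars (M (shift k q) (shift k r) (shift k s)) \<subseteq> {..<k}"
    unfolding admissible_def by blast
  then show ?case by (auto simp: vars_shift intro!: free_for_bound)
next
  case (PAll y \<phi>)
  have "x \<in> pfree_vars \<phi>" if "x + k \<in> free_vars (tr k M \<phi>)"
    using free_vars_tr[OF PAll.prems(1), of \<phi>] that by auto
  then show ?case using PAll by (auto simp: vars_shift)
qed auto

lemma length_binary: "length (binary n) \<le> n + 1"
proof (induction n rule: less_induct)
  case (less n)
  show ?case
  proof (cases "n < 2")
    case False
    then show ?thesis using less[of "n div 2"] by (subst binary.simps) auto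
  qed (subst binary.simps, auto)
qed

lemma tm_length_pos: "tm_length t > 0"
  by (cases t) auto

lemma tm_length_shift: "\<exists>C. \<forall>k. tm_length (shift k t) \<le> C * (k + 1)"
proof (induction t)
  case (Var x)
  have "tm_length (shift k (Var x)) \<le> (x + 2) * (k + 1)" for k
    using length_binary[of "x + k"] by simp
  then show ?case by blast
next
  case (Add s t)
  then obtain C D where CD: "\<And>k. tm_length (shift k s) \<le> C * (k + 1)" "\<And>k. tm_length (shift k t) \<le> D * (k + 1)"
    by blast
  have "tm_length (shift k (Add s t)) \<le> (C + D + 3) * (k + 1)" for k
    using CD[of k] by (simp add: algebra_simps)
  then show ?case by blast
qed (auto intro: exI[of _ 1])

text \<open>The constant depends on the formula alone. The square comes from the occurrences of \<open>M\<close>: a factor \<open>w\<close>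
  for \<open>M\<close> itself and another one for the indices of the shifted variables.\<close>

lemma fm_length_tr: "\<exists>C. \<forall>k w M. admissible k w M \<longrightarrow> fm_length (tr k M \<phi>) \<le> C * w\<^sup>2"
proof (induction \<phi>)
  case (PEq s t)
  obtain C D where CD: "\<And>k. tm_length (shift k s) \<le> C * (k + 1)" "\<And>k. tm_length (shift k t) \<le> D * (k + 1)"
    using tm_length_shift by meson
  have "fm_length (tr k M (PEq s t)) \<le> (C + D + 3) * w\<^sup>2" if "admissible k w M" for k w M
  proof -
    have w: "k + 1 \<le> w" using that by (simp add: admissible_def)
    have "fm_length (tr k M (PEq s t)) \<le> (C + D + 3) * (k + 1)"
      using CD[of k] by (simp add: fm_length_def algebra_simps)
    also have "\<dots> \<le> (C + D + 3) * w\<^sup>2"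
      using w self_le_power[of w 2] by (intro mult_left_mono) auto
    finally show ?thesis .
  qed
  then show ?case by blast
next
  case (PRel r s t)
  obtain B C D where CD: "\<And>k. tm_length (shift k r) \<le> B * (k + 1)"
    "\<And>k. tm_length (shift k s) \<le> C * (k + 1)" "\<And>k. tm_length (shift k t) \<le> D * (k + 1)"
    using tm_length_shift by meson
  have "fm_length (tr k M (PRel r s t)) \<le> (B + C + D) * w\<^sup>2" if "admissible k w M" for k w M
  proof -
    have w: "k + 1 \<le> w" using that by (simp add: admissible_def)
    have "fm_length (tr k M (PRel r s t)) \<le>
        w * (tm_length (shift k r) + tm_length (shift k s) + tm_length (shift k t))"
      using that by (simp add: admissible_def)
    also have "\<dots> \<le> w * ((B + C + D) * (k + 1))"
      using CD[of k] by (intro mult_left_mono) (auto simp: algebra_simps)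
    also have "\<dots> \<le> w * ((B + C + D) * w)"
      using w by (intro mult_left_mono) auto
    finally show ?thesis by (simp add: power2_eq_square algebra_simps)
  qed
  then show ?case by blast
next
  case (PNeg \<phi>)
  then obtain C where C: "\<And>k w M. admissible k w M \<Longrightarrow> fm_length (tr k M \<phi>) \<le> C * w\<^sup>2" by blast
  have "fm_length (tr k M (PNeg \<phi>)) \<le> (C + 1) * w\<^sup>2" if "admissible k w M" for k w M
  proof -
    have "1 \<le> w\<^sup>2" using that by (simp add: admissible_def)
    then show ?thesis using C[OF that] by (simp add: fm_length_def)
  qed
  then show ?case by blast
next
  case (PImp \<phi> \<psi>)
  then obtain C D where CD: "\<And>k w M. admissible k w M \<Longrightarrow> fm_length (tr k M \<phi>) \<le> C * w\<^sup>2"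
    "\<And>k w M. admissible k w M \<Longrightarrow> fm_length (tr k M \<psi>) \<le> D * w\<^sup>2" by blast
  have "fm_length (tr k M (PImp \<phi> \<psi>)) \<le> (C + D + 3) * w\<^sup>2" if "admissible k w M" for k w M
  proof -
    have "1 \<le> w\<^sup>2" using that by (simp add: admissible_def)
    then show ?thesis using CD[OF that] by (simp add: fm_length_def algebra_simps)
  qed
  then show ?case by blast
next
  case (PAll x \<phi>)
  then obtain C where C: "\<And>k w M. admissible k w M \<Longrightarrow> fm_length (tr k M \<phi>) \<le> C * w\<^sup>2" by blast
  have "fm_length (tr k M (PAll x \<phi>)) \<le> (C + x + 3) * w\<^sup>2" if "admissible k w M" for k w M
  proof -
    have "k + 1 \<le> w" using that by (simp add: admissible_def)
    moreover have "w \<le> w\<^sup>2" "1 \<le> w\<^sup>2" using self_le_power[of w 2] that by (auto simp: admissible_def)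
    moreover have "x * 1 \<le> x * w\<^sup>2" by (rule mult_left_mono) (use \<open>1 \<le> w\<^sup>2\<close> in auto)
    moreover have "fm_length (tr k M (PAll x \<phi>)) \<le> fm_length (tr k M \<phi>) + x + k + 3"
      using length_binary[of "x + k"] by (simp add: fm_length_def)
    ultimately have "fm_length (tr k M (PAll x \<phi>)) \<le> C * w\<^sup>2 + x * w\<^sup>2 + 3 * w\<^sup>2"
      using C[OF that] by linarith
    then show ?thesis by (simp add: algebra_simps)
  qed
  then show ?case by blast
qed

definition provable_within :: "fm set \<Rightarrow> nat \<Rightarrow> fm \<Rightarrow> bool" where
  "provable_within T L \<phi> \<longleftrightarrow> (\<exists>\<pi>. proves_by T \<pi> \<phi> \<and> proof_length \<pi> \<le> L)"

lemma proof_length_append: "proof_length (\<pi> @ \<rho>) = proof_length \<pi> + proof_length \<rho>"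
  by (simp add: proof_length_def write_proof_def)

lemma proof_length_single: "proof_length [\<phi>] = fm_length \<phi> + 1"
  by (simp add: proof_length_def write_proof_def fm_length_def)

text \<open>Positions in the second proof move by the length of the first, and references move with them.\<close>

lemma proof_in_append:
  assumes "proof_in T \<pi>" "proof_in T \<rho>" shows "proof_in T (\<pi> @ \<rho>)"
  unfolding proof_in_def
proof (intro allI impI)
  fix i assume i: "i < length (\<pi> @ \<rho>)"
  let ?\<sigma> = "\<pi> @ \<rho>"
  show "logical_axiom (?\<sigma> ! i) \<or> ?\<sigma> ! i \<in> T \<or>
     (\<exists>j<i. \<exists>k<i. ?\<sigma> ! k = Imp (?\<sigma> ! j) (?\<sigma> ! i)) \<or>
     (\<exists>j<i. \<exists>x. ?\<sigma> ! i = Forall x (?\<sigma> ! j))"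
  proof (cases "i < length \<pi>")
    case True
    have "?\<sigma> ! j = \<pi> ! j" if "j \<le> i" for j using that True by (simp add: nth_append)
    with True assms(1) show ?thesis unfolding proof_in_def by (metis less_imp_le order_refl)
  next
    case False
    define n where "n = length \<pi>"
    obtain m where m: "i = n + m" "m < length \<rho>"
      using False i unfolding n_def by (metis add_less_cancel_left le_Suc_ex length_append not_less)
    have nth: "?\<sigma> ! (n + j) = \<rho> ! j" for j by (simp add: n_def)
    from assms(2) m(2) consider "logical_axiom (\<rho> ! m)" | "\<rho> ! m \<in> T"
      | j k where "j < m" "k < m" "\<rho> ! k = Imp (\<rho> ! j) (\<rho> ! m)"
      | j x where "j < m" "\<rho> ! m = Forall x (\<rho> ! j)"
      unfolding proof_in_def by blast
    then show ?thesis
    proof cases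
      case 3
      then show ?thesis unfolding m(1) nth
        by (intro disjI2 disjI1) (metis nth add_less_cancel_left)
    next
      case 4
      then show ?thesis unfolding m(1) nth
        by (intro disjI2) (metis nth add_less_cancel_left)
    qed (use nth m(1) in auto)
  qed
qed

lemma proof_in_snoc:
  assumes "proof_in T \<pi>"
    and "logical_axiom \<phi> \<or> \<phi> \<in> T \<or> (\<exists>\<psi>\<in>set \<pi>. Imp \<psi> \<phi> \<in> set \<pi>) \<or> (\<exists>\<psi>\<in>set \<pi>. \<exists>x. \<phi> = Forall x \<psi>)"
  shows "proof_in T (\<pi> @ [\<phi>])"
  unfolding proof_in_def
proof (intro allI impI)
  fix i assume i: "i < length (\<pi> @ [\<phi>])"
  let ?\<sigma> = "\<pi> @ [\<phi>]"
  show "logical_axiom (?\<sigma> ! i) \<or> ?\<sigma> ! i \<in> T \<or>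
     (\<exists>j<i. \<exists>k<i. ?\<sigma> ! k = Imp (?\<sigma> ! j) (?\<sigma> ! i)) \<or>
     (\<exists>j<i. \<exists>x. ?\<sigma> ! i = Forall x (?\<sigma> ! j))"
  proof (cases "i < length \<pi>")
    case True
    have "?\<sigma> ! j = \<pi> ! j" if "j \<le> i" for j using that True by (simp add: nth_append)
    with True assms(1) show ?thesis unfolding proof_in_def by (metis less_imp_le order_refl)
  next
    case False
    then have i: "i = length \<pi>" using i by simp
    have nth: "?\<sigma> ! i = \<phi>" "\<And>j. j < i \<Longrightarrow> ?\<sigma> ! j = \<pi> ! j" using i by (auto simp: nth_append)
    from assms(2) show ?thesis
      unfolding nth(1) by (metis i in_set_conv_nth nth(2))
  qed
qed

lemma provable_within_mono: "provable_within T L \<phi> \<Longrightarrow> L \<le> L' \<Longrightarrow> provable_within T L' \<phi>"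
  unfolding provable_within_def by (meson order_trans)

lemma provable_within_axiom: "logical_axiom \<phi> \<or> \<phi> \<in> T \<Longrightarrow> provable_within T (fm_length \<phi> + 1) \<phi>"
  unfolding provable_within_def proves_by_def
  by (intro exI[of _ "[\<phi>]"]) (auto simp: proof_in_def proof_length_single)

lemma provable_within_mp:
  assumes "provable_within T L (Imp \<phi> \<psi>)" "provable_within T L' \<phi>"
  shows "provable_within T (L + L' + fm_length \<psi> + 1) \<psi>"
proof -
  obtain \<pi> \<rho> where \<pi>: "proof_in T \<pi>" "\<pi> \<noteq> []" "last \<pi> = Imp \<phi> \<psi>" "proof_length \<pi> \<le> L"
    and \<rho>: "proof_in T \<rho>" "\<rho> \<noteq> []" "last \<rho> = \<phi>" "proof_length \<rho> \<le> L'"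
    using assms unfolding provable_within_def proves_by_def by blast
  have "Imp \<phi> \<psi> \<in> set (\<pi> @ \<rho>)" "\<phi> \<in> set (\<pi> @ \<rho>)"
    using last_in_set[OF \<pi>(2)] last_in_set[OF \<rho>(2)] \<pi>(3) \<rho>(3) by auto
  then have "proof_in T ((\<pi> @ \<rho>) @ [\<psi>])"
    by (intro proof_in_snoc proof_in_append \<pi>(1) \<rho>(1)) blast
  then show ?thesis
    unfolding provable_within_def proves_by_def using \<pi>(4) \<rho>(4)
    by (intro exI[of _ "(\<pi> @ \<rho>) @ [\<psi>]"]) (auto simp: proof_length_append proof_length_single)
qed

lemma provable_within_gen:
  assumes "provable_within T L \<phi>"
  shows "provable_within T (L + fm_length (Forall x \<phi>) + 1) (Forall x \<phi>)"
proof -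
  obtain \<pi> where \<pi>: "proof_in T \<pi>" "\<pi> \<noteq> []" "last \<pi> = \<phi>" "proof_length \<pi> \<le> L"
    using assms unfolding provable_within_def proves_by_def by blast
  have "\<phi> \<in> set \<pi>" using last_in_set[OF \<pi>(2)] \<pi>(3) by auto
  then have "proof_in T (\<pi> @ [Forall x \<phi>])"
    by (intro proof_in_snoc \<pi>(1)) blast
  then show ?thesis
    unfolding provable_within_def proves_by_def using \<pi>(4)
    by (intro exI[of _ "\<pi> @ [Forall x \<phi>]"]) (auto simp: proof_length_append proof_length_single)
qed

lemma translate_axiom:
  assumes "\<And>k w M. admissible k w M \<Longrightarrow> logical_axiom (tr k M \<phi>)"
  shows "\<exists>C. \<forall>k w M T. admissible k w M \<longrightarrow> provable_within T (C * w\<^sup>2) (tr k M \<phi>)"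
proof -
  obtain C where C: "\<And>k w M. admissible k w M \<Longrightarrow> fm_length (tr k M \<phi>) \<le> C * w\<^sup>2"
    using fm_length_tr by blast
  have "provable_within T ((C + 1) * w\<^sup>2) (tr k M \<phi>)" if a: "admissible k w M" for k w M T
  proof -
    have "1 \<le> w\<^sup>2" using a by (simp add: admissible_def)
    then show ?thesis
      using C[OF a] by (intro provable_within_mono[OF provable_within_axiom]) (auto simp: assms[OF a])
  qed
  then show ?thesis by blast
qed

text \<open>A derivation is a fixed finite object, so its translation has a fixed number of lines, each of length
  \<open>O(w\<^sup>2)\<close>. This is what turns mere derivability in the extended language into short arithmetical
  proofs, with one constant for all \<open>M\<close>.\<close>

lemma translate: "prov \<phi> \<Longrightarrow> \<exists>C. \<forall>k w M T. admissible k w M \<longrightarrow> provable_within T (C * w\<^sup>2) (tr k M \<phi>)"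
proof (induction rule: prov.induct)
  case (inst t x \<phi>)
  show ?case
    by (rule translate_axiom) (simp add: tr_psubst logical_axiom.intros(4) free_for_tr[OF _ inst])
next
  case (distr x \<phi> \<psi>)
  show ?case
  proof (rule translate_axiom)
    fix k w M assume "admissible k w M"
    from free_vars_tr[OF this, of \<phi>] distr have "x + k \<notin> free_vars (tr k M \<phi>)" by auto
    then show "logical_axiom (tr k M (PImp (PAll x (PImp \<phi> \<psi>)) (PImp \<phi> (PAll x \<psi>))))"
      by (simp add: logical_axiom.intros(5))
  qed
next
  case (eq_subst s x \<phi> t)
  show ?case
    by (rule translate_axiom)
      (simp add: tr_psubst logical_axiom.intros(7) free_for_tr[OF _ eq_subst(1)] free_for_tr[OF _ eq_subst(2)])
next
  case (mp \<phi> \<psi>)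
  obtain A where A: "\<And>k w M T. admissible k w M \<Longrightarrow> provable_within T (A * w\<^sup>2) (tr k M (PImp \<phi> \<psi>))"
    using mp.IH(1) by blast
  obtain B where B: "\<And>k w M T. admissible k w M \<Longrightarrow> provable_within T (B * w\<^sup>2) (tr k M \<phi>)"
    using mp.IH(2) by blast
  obtain C where C: "\<And>k w M. admissible k w M \<Longrightarrow> fm_length (tr k M \<psi>) \<le> C * w\<^sup>2"
    using fm_length_tr by blast
  have "provable_within T ((A + B + C + 1) * w\<^sup>2) (tr k M \<psi>)" if a: "admissible k w M" for k w M T
  proof -
    have "1 \<le> w\<^sup>2" using a by (simp add: admissible_def)
    have "provable_within T (A * w\<^sup>2 + B * w\<^sup>2 + fm_length (tr k M \<psi>) + 1) (tr k M \<psi>)"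
      using A[OF a, of T] by (intro provable_within_mp[OF _ B[OF a]]) simp
    then show ?thesis
      by (rule provable_within_mono) (use C[OF a] \<open>1 \<le> w\<^sup>2\<close> in \<open>simp add: algebra_simps\<close>)
  qed
  then show ?case by blast
next
  case (gen \<phi> x)
  obtain A where A: "\<And>k w M T. admissible k w M \<Longrightarrow> provable_within T (A * w\<^sup>2) (tr k M \<phi>)"
    using gen.IH by blast
  obtain C where C: "\<And>k w M. admissible k w M \<Longrightarrow> fm_length (tr k M (PAll x \<phi>)) \<le> C * w\<^sup>2"
    using fm_length_tr by blast
  have "provable_within T ((A + C + 1) * w\<^sup>2) (tr k M (PAll x \<phi>))" if a: "admissible k w M" for k w M T
  proof -
    have "1 \<le> w\<^sup>2" using a by (simp add: admissible_def)
    have "provable_within T (A * w\<^sup>2 + fm_length (tr k M (PAll x \<phi>)) + 1) (tr k M (PAll x \<phi>))"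
      using provable_within_gen[OF A[OF a, of T], of "x + k"] by simp
    then show ?thesis
      by (rule provable_within_mono) (use C[OF a] \<open>1 \<le> w\<^sup>2\<close> in \<open>simp add: algebra_simps\<close>)
  qed
  then show ?case by blast
qed (rule translate_axiom, simp add: logical_axiom.intros(1,2,3,6))+

section \<open>Multiplication by small numbers\<close>

fun PConj :: "pfm list \<Rightarrow> pfm" where
  "PConj [] = PEq Zero Zero"
| "PConj (\<phi> # \<phi>s) = PCon \<phi> (PConj \<phi>s)"

lemma psem_PConj: "psem D z u f R e (PConj \<phi>s) \<longleftrightarrow> (\<forall>\<phi>\<in>set \<phi>s. psem D z u f R e \<phi>)"
  by (induction \<phi>s) auto

text \<open>The axioms of the base theory with their variables starting at \<open>k\<close>. They are carried along as
  hypotheses, because a shift of variables leads out of the set of axioms as literally stated.\<close>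

definition arith_axioms :: "nat \<Rightarrow> pfm list" where
  "arith_axioms k = (let x = Var k; y = Var (k + 1); z = Var (k + 2) in
    [PAll k (PAll (k + 1) (PAll (k + 2) (PEq (Add (Add x y) z) (Add x (Add y z))))),
     PAll k (PAll (k + 1) (PEq (Add x y) (Add y x))),
     PAll k (PEq (Add x Zero) x),
     PAll k (PAll (k + 1) (PAll (k + 2) (PImp (PEq (Add x z) (Add y z)) (PEq x y)))),
     PAll k (PNeg (PEq (Add x One) Zero)),
     PAll k (PImp (PNeg (PEq x Zero)) (PEx (k + 1) (PEq x (Add y One)))),
     PAll k (PAll (k + 1) (PDis (PEx (k + 2) (PEq (Add x z) y)) (PEx (k + 2) (PEq (Add y z) x))))])"

text \<open>The properties of the relation \<open>F a q y\<close>, to be read as \<open>a \<cdot> q = y\<close>, that are preserved from one level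
  to the next. The formula \<open>F a 0 0\<close> expresses that \<open>a\<close> is among the numbers by which multiplication is
  available.\<close>

definition mult_axioms :: "nat \<Rightarrow> (tm \<Rightarrow> tm \<Rightarrow> tm \<Rightarrow> pfm) \<Rightarrow> pfm list" where
  "mult_axioms k F = (let a = Var k; q = Var (k + 1); y = Var (k + 2); q' = Var (k + 3); y' = Var (k + 4) in
    [PAll k (PAll (k + 1) (PAll (k + 2) (PImp (F a q y) (F a Zero Zero)))),
     PAll k (PAll (k + 1) (PImp (F a Zero Zero) (PEx (k + 2) (F a q y)))),
     PAll k (PAll (k + 1) (PAll (k + 2) (PAll (k + 4) (PImp (F a q y) (PImp (F a q y') (PEq y y')))))),
     PAll k (PAll (k + 1) (PAll (k + 2) (PAll (k + 3) (PAll (k + 4)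
       (PImp (F a q y) (PImp (F a q' y') (F a (Add q q') (Add y y')))))))),
     PAll k (PImp (F a Zero Zero) (F a One a))])"

definition mult_theory :: "nat \<Rightarrow> (tm \<Rightarrow> tm \<Rightarrow> tm \<Rightarrow> pfm) \<Rightarrow> pfm" where
  "mult_theory k F = PConj (arith_axioms k @ mult_axioms k F)"

definition base_fm :: "tm \<Rightarrow> tm \<Rightarrow> tm \<Rightarrow> pfm" where
  "base_fm a q y = PDis (PCon (PEq a Zero) (PEq y Zero)) (PCon (PEq a One) (PEq y q))"

definition triple :: "nat \<Rightarrow> tm \<Rightarrow> tm \<Rightarrow> tm \<Rightarrow> pfm" where
  "triple k r s t = PCon (PEq (Var (k + 7)) r) (PCon (PEq (Var (k + 8)) s) (PEq (Var (k + 9)) t))"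

text \<open>If \<open>a = c v + w\<close> then \<open>a q = c (v q) + w q\<close>, so four multiplications by smaller numbers give a
  multiplication by \<open>a\<close>; this roughly squares the range of \<open>a\<close>. Following Fischer and Rabin, the four
  conditions are merged into a single occurrence of \<open>PRel\<close> under universal quantifiers: with four copies
  the formulas would grow exponentially.\<close>

definition step_fm :: "nat \<Rightarrow> tm \<Rightarrow> tm \<Rightarrow> tm \<Rightarrow> pfm" where
  "step_fm k a q y =
    (let u = Var k; v = Var (k + 1); w = Var (k + 2);
       y1 = Var (k + 3); y2 = Var (k + 4); y3 = Var (k + 5); y4 = Var (k + 6) in
     PEx k (PEx (k + 1) (PEx (k + 2) (PEx (k + 3) (PEx (k + 4) (PEx (k + 5) (PEx (k + 6)
      (PCon (PEq a (Add y1 w)) (PCon (PEq y (Add y3 y4))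
       (PAll (k + 7) (PAll (k + 8) (PAll (k + 9)
         (PImp (PDis (triple k u v y1) (PDis (triple k v q y2) (PDis (triple k u y2 y3) (triple k w q y4))))
            (PRel (Var (k + 7)) (Var (k + 8)) (Var (k + 9))))))))))))))))"

definition pinduction :: "nat \<Rightarrow> pfm \<Rightarrow> pfm" where
  "pinduction x \<phi> = PImp (PCon (psubst x Zero \<phi>) (PAll x (PImp \<phi> (psubst x (Add (Var x) One) \<phi>))))
     (PAll x \<phi>)"

text \<open>The induction on the second factor, here variable 10, by which the new relation is shown to be
  functional. It has no other free variable. The numbering leaves 0 to 9 to \<open>step_fm\<close>.\<close>

definition unique_fm :: pfm where
  "unique_fm = PAll 11 (PAll 12 (PAll 13 (PImp (step_fm 0 (Var 11) (Var 10) (Var 12))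
     (PImp (step_fm 0 (Var 11) (Var 10) (Var 13)) (PEq (Var 12) (Var 13))))))"

text \<open>The property of the dividend, variable 1, on which the induction for division with remainder is
  carried out, for all divisors at once.\<close>

definition division_fm :: pfm where
  "division_fm = PAll 0 (PImp (PRel (Var 0) Zero Zero) (PImp (PNeg (PEq (Var 0) Zero))
     (PEx 2 (PEx 3 (PEx 4 (PCon (PRel (Var 0) (Var 2) (Var 3)) (PCon (PEq (Var 1) (Add (Var 3) (Var 4)))
       (PEx 5 (PEq (Add (Add (Var 4) (Var 5)) One) (Var 0))))))))))"

locale addition_structure =
  fixes D :: "'a set" and z u :: 'a and f :: "'a \<Rightarrow> 'a \<Rightarrow> 'a"
  assumes z: "z \<in> D" and u: "u \<in> D" and f: "a \<in> D \<Longrightarrow> b \<in> D \<Longrightarrow> f a b \<in> D"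
begin

lemma val_in: "(\<And>x. e x \<in> D) \<Longrightarrow> val z u f e t \<in> D"
  by (induction t) (auto simp: z u f)

lemma val_upd: "x \<notin> vars_tm t \<Longrightarrow> val z u f (e(x := d)) t = val z u f e t"
  by (rule val_cong) auto

definition step_rel :: "('a \<Rightarrow> 'a \<Rightarrow> 'a \<Rightarrow> bool) \<Rightarrow> 'a \<Rightarrow> 'a \<Rightarrow> 'a \<Rightarrow> bool" where
  "step_rel R a q y \<longleftrightarrow> (\<exists>u\<in>D. \<exists>v\<in>D. \<exists>w\<in>D. \<exists>y1\<in>D. \<exists>y2\<in>D. \<exists>y3\<in>D. \<exists>y4\<in>D.
     a = f y1 w \<and> y = f y3 y4 \<and> R u v y1 \<and> R v q y2 \<and> R u y2 y3 \<and> R w q y4)"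

lemma step_relE:
  assumes "step_rel R a q y"
  obtains c v w y1 y2 y3 y4 where
    "c \<in> D" "v \<in> D" "w \<in> D" "y1 \<in> D" "y2 \<in> D" "y3 \<in> D" "y4 \<in> D"
    "a = f y1 w" "y = f y3 y4" "R c v y1" "R v q y2" "R c y2 y3" "R w q y4"
  using assms unfolding step_rel_def
  apply (elim bexE conjE)
  subgoal for c v w y1 y2 y3 y4 by (rule that[of c v w y1 y2 y3 y4])
  done

lemma step_relI:
  "c \<in> D \<Longrightarrow> v \<in> D \<Longrightarrow> w \<in> D \<Longrightarrow> y1 \<in> D \<Longrightarrow> y2 \<in> D \<Longrightarrow> y3 \<in> D \<Longrightarrow> y4 \<in> D \<Longrightarrow>
    a = f y1 w \<Longrightarrow> y = f y3 y4 \<Longrightarrow> R c v y1 \<Longrightarrow> R v q y2 \<Longrightarrow> R c y2 y3 \<Longrightarrow> R w q y4 \<Longrightarrow> step_rel R a q y"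
  unfolding step_rel_def
  by (rule bexI[of _ c], rule bexI[of _ v], rule bexI[of _ w], rule bexI[of _ y1], rule bexI[of _ y2],
      rule bexI[of _ y3], rule bexI[of _ y4]) simp_all

text \<open>The universally quantified implication unfolds to the four relational conditions.\<close>

lemma psem_step_fm:
  assumes e: "\<And>x. e x \<in> D" and vars: "vars_tm a \<union> vars_tm q \<union> vars_tm y \<subseteq> {k + 10..}"
  shows "psem D z u f R e (step_fm k a q y) \<longleftrightarrow>
    step_rel R (val z u f e a) (val z u f e q) (val z u f e y)"
proof -
  have n: "k \<notin> vars_tm t" "Suc k \<notin> vars_tm t" "Suc (Suc k) \<notin> vars_tm t" "k + 3 \<notin> vars_tm t"
    "k + 4 \<notin> vars_tm t" "k + 5 \<notin> vars_tm t" "k + 6 \<notin> vars_tm t" "k + 7 \<notin> vars_tm t"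
    "k + 8 \<notin> vars_tm t" "k + 9 \<notin> vars_tm t" if "t \<in> {a, q, y}" for t
    using vars that by fastforce+
  have q: "val z u f e q \<in> D" using val_in e by blast
  show ?thesis
    unfolding step_rel_def
    by (simp add: step_fm_def triple_def Let_def val_upd n)
      (intro bex_cong conj_cong refl, use q in auto)
qed

end

locale presburger = addition_structure +
  assumes assoc: "a \<in> D \<Longrightarrow> b \<in> D \<Longrightarrow> c \<in> D \<Longrightarrow> f (f a b) c = f a (f b c)"
    and comm: "a \<in> D \<Longrightarrow> b \<in> D \<Longrightarrow> f a b = f b a"
    and zero: "a \<in> D \<Longrightarrow> f a z = a"
    and cancel: "a \<in> D \<Longrightarrow> b \<in> D \<Longrightarrow> c \<in> D \<Longrightarrow> f a c = f b c \<Longrightarrow> a = b"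
    and succ: "a \<in> D \<Longrightarrow> f a u \<noteq> z"
    and pred: "a \<in> D \<Longrightarrow> a \<noteq> z \<Longrightarrow> \<exists>b\<in>D. a = f b u"
    and total: "a \<in> D \<Longrightarrow> b \<in> D \<Longrightarrow> (\<exists>c\<in>D. f a c = b) \<or> (\<exists>c\<in>D. f b c = a)"

lemma (in addition_structure) psem_arith_axioms:
  "(\<forall>\<phi>\<in>set (arith_axioms k). psem D z u f R e \<phi>) \<longleftrightarrow> presburger D z u f"
  unfolding presburger_def presburger_axioms_def using addition_structure_axioms
  by (simp add: arith_axioms_def Let_def) (intro arg_cong2[where f = "(\<and>)"]; blast)

text \<open>The meaning of \<open>mult_axioms\<close>: on the \<open>a\<close> with \<open>R a z z\<close> the relation is the graph of an additive
  function of \<open>q\<close> that maps 1 to \<open>a\<close>.\<close>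

locale multiplication = presburger +
  fixes R :: "'a \<Rightarrow> 'a \<Rightarrow> 'a \<Rightarrow> bool"
  assumes dom: "a \<in> D \<Longrightarrow> q \<in> D \<Longrightarrow> y \<in> D \<Longrightarrow> R a q y \<Longrightarrow> R a z z"
    and ex: "a \<in> D \<Longrightarrow> q \<in> D \<Longrightarrow> R a z z \<Longrightarrow> \<exists>y\<in>D. R a q y"
    and unique: "a \<in> D \<Longrightarrow> q \<in> D \<Longrightarrow> y \<in> D \<Longrightarrow> y' \<in> D \<Longrightarrow> R a q y \<Longrightarrow> R a q y' \<Longrightarrow> y = y'"
    and add: "a \<in> D \<Longrightarrow> q \<in> D \<Longrightarrow> y \<in> D \<Longrightarrow> q' \<in> D \<Longrightarrow> y' \<in> D \<Longrightarrow> R a q y \<Longrightarrow> R a q' y' \<Longrightarrow>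
      R a (f q q') (f y y')"
    and one: "a \<in> D \<Longrightarrow> R a z z \<Longrightarrow> R a u a"

lemma (in presburger) psem_mult_axioms:
  assumes F: "\<And>e r s t. (\<And>x. e x \<in> D) \<Longrightarrow> vars_tm r \<union> vars_tm s \<union> vars_tm t \<subseteq> {k..} \<Longrightarrow>
      psem D z u f R e (F r s t) \<longleftrightarrow> Q (val z u f e r) (val z u f e s) (val z u f e t)"
    and e: "\<And>x. e x \<in> D"
  shows "(\<forall>\<phi>\<in>set (mult_axioms k F). psem D z u f R e \<phi>) \<longleftrightarrow> multiplication D z u f Q"
  unfolding multiplication_def multiplication_axioms_def using presburger_axioms e
  by (simp add: mult_axioms_def Let_def F) (intro arg_cong2[where f = "(\<and>)"]; blast)

context multiplication
begin

lemma right_zero: "a \<in> D \<Longrightarrow> y \<in> D \<Longrightarrow> R a z y \<Longrightarrow> y = z"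
  using dom unique z by blast

text \<open>A subtraction law, from totality, additivity and uniqueness.\<close>

lemma right_add:
  assumes "a \<in> D" "q \<in> D" "q' \<in> D" "y \<in> D" "y' \<in> D" "R a (f q q') y" "R a q' y'"
  shows "\<exists>x\<in>D. R a q x \<and> y = f x y'"
proof -
  obtain x where x: "x \<in> D" "R a q x" using ex[of a q] dom[of a q' y'] assms by blast
  then have "R a (f q q') (f x y')" using add[of a q x q' y'] assms by blast
  then have "y = f x y'" using unique[of a "f q q'" y "f x y'"] f assms x by blast
  with x show ?thesis by blast
qed

lemma right_succ:
  assumes "a \<in> D" "q \<in> D" "y \<in> D" "R a (f q u) y"
  shows "\<exists>x\<in>D. R a q x \<and> y = f x a"
  using right_add[of a q u y a] one[of a] dom[of a "f q u" y] assms u f by blast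

lemma shuffle: "a \<in> D \<Longrightarrow> b \<in> D \<Longrightarrow> c \<in> D \<Longrightarrow> d \<in> D \<Longrightarrow> f (f a b) (f c d) = f (f a c) (f b d)"
  using assoc[of a b "f c d"] assoc[of b c d] assoc[of c b d] assoc[of a c "f b d"] comm[of b c] f
  by simp

lemma step_unit: assumes "step_rel R a z z" "a \<in> D" shows "step_rel R a u a"
proof -
  obtain c v w y1 y2 y3 y4 where *:
    "c \<in> D" "v \<in> D" "w \<in> D" "y1 \<in> D" "y2 \<in> D" "y3 \<in> D" "y4 \<in> D"
    "a = f y1 w" "z = f y3 y4" "R c v y1" "R v z y2" "R c y2 y3" "R w z y4"
    by (rule step_relE[OF assms(1)])
  then have "R v z z" "R w z z" using dom[of v z y2] dom[of w z y4] z by simp_all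
  then have "R v u v" "R w u w" using one * by simp_all
  with * show ?thesis by (intro step_relI[of c v w y1 v y1 w])
qed

lemma step_dom: assumes "step_rel R a q y" "q \<in> D" shows "step_rel R a z z"
proof -
  obtain c v w y1 y2 y3 y4 where *:
    "c \<in> D" "v \<in> D" "w \<in> D" "y1 \<in> D" "y2 \<in> D" "y3 \<in> D" "y4 \<in> D"
    "a = f y1 w" "y = f y3 y4" "R c v y1" "R v q y2" "R c y2 y3" "R w q y4"
    by (rule step_relE[OF assms(1)])
  then have "R v z z" "R c z z" "R w z z" 
    using dom[of v q y2] dom[of c v y1] dom[of w q y4] assms(2) by simp_all
  moreover have "z = f z z" using zero[OF z] by simp
  ultimately show ?thesis using * z by (intro step_relI[of c v w y1 z z z])
qed

lemma step_ex: assumes "step_rel R a z z" "q \<in> D" shows "\<exists>y\<in>D. step_rel R a q y"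
proof -
  obtain c v w y1 y2 y3 y4 where *:
    "c \<in> D" "v \<in> D" "w \<in> D" "y1 \<in> D" "y2 \<in> D" "y3 \<in> D" "y4 \<in> D"
    "a = f y1 w" "z = f y3 y4" "R c v y1" "R v z y2" "R c y2 y3" "R w z y4"
    by (rule step_relE[OF assms(1)])
  then have "R v z z" "R c z z" "R w z z" 
    using dom[of v z y2] dom[of c v y1] dom[of w z y4] z by simp_all
  then obtain x2 x3 x4 where "x2 \<in> D" "R v q x2" "x3 \<in> D" "R c x2 x3" "x4 \<in> D" "R w q x4"
    
    using ex[of v q] ex[of c] ex[of w q] * assms(2) by metis
  with * have "step_rel R a q (f x3 x4)" by (intro step_relI[of c v w y1 x2 x3 x4]) simp_all
  then show ?thesis using f \<open>x3 \<in> D\<close> \<open>x4 \<in> D\<close> by blast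
qed

lemma step_zero: assumes "step_rel R a z y" shows "y = z"
proof -
  obtain c v w y1 y2 y3 y4 where *:
    "c \<in> D" "v \<in> D" "w \<in> D" "y1 \<in> D" "y2 \<in> D" "y3 \<in> D" "y4 \<in> D"
    "a = f y1 w" "y = f y3 y4" "R c v y1" "R v z y2" "R c y2 y3" "R w z y4"
    by (rule step_relE[OF assms])
  then have "y2 = z" "y4 = z" using right_zero[of v y2] right_zero[of w y4] by simp_all
  with * have "y3 = z" using right_zero[of c y3] by simp
  with * \<open>y4 = z\<close> show ?thesis using zero z by simp
qed

text \<open>The converse of adding \<open>a\<close>; together with the value at 0 it determines the relation by induction
  on \<open>q\<close>, whichever decomposition of \<open>a\<close> is used.\<close>

lemma step_pred:
  assumes "step_rel R a (f q u) y" "q \<in> D"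
  shows "\<exists>x\<in>D. step_rel R a q x \<and> y = f x a"
proof -
  obtain c v w y1 y2 y3 y4 where *:
    "c \<in> D" "v \<in> D" "w \<in> D" "y1 \<in> D" "y2 \<in> D" "y3 \<in> D" "y4 \<in> D"
    "a = f y1 w" "y = f y3 y4" "R c v y1" "R v (f q u) y2" "R c y2 y3" "R w (f q u) y4"
    by (rule step_relE[OF assms(1)])
  obtain x2 where x2: "x2 \<in> D" "R v q x2" "y2 = f x2 v"
    using right_succ[of v q y2] * assms(2) by blast
  obtain x4 where x4: "x4 \<in> D" "R w q x4" "y4 = f x4 w"
    using right_succ[of w q y4] * assms(2) by blast
  obtain x3 where x3: "x3 \<in> D" "R c x2 x3" "y3 = f x3 y1" using right_add[of c x2 v y3 y1] * x2 by blast
  have "step_rel R a q (f x3 x4)" using * x2 x3 x4 by (intro step_relI[of c v w y1 x2 x3 x4]) simp_all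
  moreover have "y = f (f x3 x4) a" using shuffle * x3 x4 by simp
  ultimately show ?thesis using f x3 x4 by blast
qed

definition step_unique_at :: "'a \<Rightarrow> bool" where
  "step_unique_at q \<longleftrightarrow> (\<forall>a\<in>D. \<forall>y\<in>D. \<forall>y'\<in>D. step_rel R a q y \<longrightarrow> step_rel R a q y' \<longrightarrow> y = y')"

text \<open>Uniqueness needs an induction because \<open>a\<close> may have several decompositions \<open>c v + w\<close>. Once it is
  known, additivity can be checked on a single decomposition.\<close>

lemma multiplication_step:
  assumes ind: "step_unique_at z \<Longrightarrow> (\<And>q. q \<in> D \<Longrightarrow> step_unique_at q \<Longrightarrow> step_unique_at (f q u)) \<Longrightarrow>
      \<forall>q\<in>D. step_unique_at q"
  shows "multiplication D z u f (step_rel R)"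
proof
  have un: "\<forall>q\<in>D. step_unique_at q"
  proof (rule ind)
    show "step_unique_at z" unfolding step_unique_at_def using step_zero by blast
    show "step_unique_at (f q u)" if q: "q \<in> D" "step_unique_at q" for q
      unfolding step_unique_at_def
    proof (intro ballI impI)
      fix a y y' assume "a \<in> D" "step_rel R a (f q u) y" "step_rel R a (f q u) y'"
      then show "y = y'" using step_pred[OF _ q(1)] q(2) unfolding step_unique_at_def by metis
    qed
  qed
  show uniq: "y = y'" if "a \<in> D" "q \<in> D" "y \<in> D" "y' \<in> D" "step_rel R a q y" "step_rel R a q y'" for a q y y'
    using un that unfolding step_unique_at_def by blast
  show "step_rel R a (f q q') (f y y')"
    if D: "a \<in> D" "q \<in> D" "y \<in> D" "q' \<in> D" "y' \<in> D"
      and s: "step_rel R a q y" "step_rel R a q' y'" for a q y q' y'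
  proof -
    obtain c v w y1 y2 y3 y4 where *:
    "c \<in> D" "v \<in> D" "w \<in> D" "y1 \<in> D" "y2 \<in> D" "y3 \<in> D" "y4 \<in> D"
    "a = f y1 w" "y = f y3 y4" "R c v y1" "R v q y2" "R c y2 y3" "R w q y4"
    by (rule step_relE[OF s(1)])
    then have "R v z z" "R c z z" "R w z z" 
      using dom[of v q y2] dom[of c v y1] dom[of w q y4] D by simp_all
    then obtain x2 x3 x4 where x: "x2 \<in> D" "R v q' x2" "x3 \<in> D" "R c x2 x3" "x4 \<in> D" "R w q' x4"

      using ex[of v q'] ex[of c] ex[of w q'] * D by metis
    then have "step_rel R a q' (f x3 x4)" using * by (intro step_relI[of c v w y1 x2 x3 x4]) simp_all
    \<comment> \<open>the second product recomputed with the decomposition of the first\<close>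
    then have "y' = f x3 x4" using uniq[OF D(1,4,5) _ s(2), of "f x3 x4"] f x by blast
    then have "f y y' = f (f y3 x3) (f y4 x4)" using shuffle * x by simp
    moreover have "R v (f q q') (f y2 x2)" "R c (f y2 x2) (f y3 x3)" "R w (f q q') (f y4 x4)"

      using add[of v q y2 q' x2] add[of c y2 y3 x2 x3] add[of w q y4 q' x4] * x D by simp_all
    moreover have "f y2 x2 \<in> D" "f y3 x3 \<in> D" "f y4 x4 \<in> D" using * x f by simp_all
    ultimately show ?thesis using *
      by (intro step_relI[of c v w y1 "f y2 x2" "f y3 x3" "f y4 x4"]) simp_all
  qed
qed (erule step_dom step_ex step_unit, assumption)+

definition divides :: "'a \<Rightarrow> bool" where
  "divides x \<longleftrightarrow> (\<forall>a\<in>D. R a z z \<longrightarrow> a \<noteq> z \<longrightarrow>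
     (\<exists>q\<in>D. \<exists>y\<in>D. \<exists>r\<in>D. R a q y \<and> x = f y r \<and> (\<exists>s\<in>D. f (f r s) u = a)))"

text \<open>When \<open>x\<close> grows by 1, either the remainder stays below \<open>a\<close> or it reaches \<open>a\<close>, and then \<open>q\<close> grows by 1
  and the remainder returns to 0.\<close>

lemma division: shows "divides z" "x \<in> D \<Longrightarrow> divides x \<Longrightarrow> divides (f x u)"
proof -
  have zl: "f z a = a" if "a \<in> D" for a using that zero comm z by metis
  have pos: "\<exists>s\<in>D. f (f z s) u = a" if "a \<in> D" "a \<noteq> z" for a
    using pred[OF that] zl by auto
  show "divides z" unfolding divides_def 
  proof (intro ballI impI)
    fix a assume a: "a \<in> D" "R a z z" "a \<noteq> z"
    show "\<exists>q\<in>D. \<exists>y\<in>D. \<exists>r\<in>D. R a q y \<and> z = f y r \<and> (\<exists>s\<in>D. f (f r s) u = a)"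
      using pos[OF a(1,3)] a(2) zero[OF z] by (intro bexI[OF _ z]) simp
  qed
  assume x: "x \<in> D" "divides x"
  show "divides (f x u)" unfolding divides_def
  proof (intro ballI impI)
    fix a assume a: "a \<in> D" "R a z z" "a \<noteq> z"
    then obtain q y r s where *: "q \<in> D" "y \<in> D" "r \<in> D" "R a q y" "x = f y r" "s \<in> D" "f (f r s) u = a"
      using x(2) unfolding divides_def by blast
    show "\<exists>q\<in>D. \<exists>y\<in>D. \<exists>r\<in>D. R a q y \<and> f x u = f y r \<and> (\<exists>s\<in>D. f (f r s) u = a)"
    proof (cases "s = z")
      case True
      then have "a = f r u" using * zero by simp
      then have "f x u = f (f y a) z" using * u f assoc zero by simp
      moreover have "R a (f q u) (f y a)" using add[of a q y u a] one[of a] * a u by simp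
      moreover have "f q u \<in> D" "f y a \<in> D" using * a u f by simp_all
      ultimately show ?thesis using pos[OF a(1,3)] z by blast
    next
      case False
      then obtain t where t: "t \<in> D" "s = f t u" using pred[of s] * by blast
      have "f (f (f r u) t) u = a"

      proof -
        have "f (f r u) t = f r s"
          using assoc[of r u t] comm[of u t] * t u by simp
        then show ?thesis using *(7) by simp
      qed
      moreover have "f x u = f y (f r u)" using * u assoc by simp
      moreover have "f r u \<in> D" using * u f by simp
      ultimately show ?thesis using *(1,2,4) t(1) by blast
    qed
  qed
qed

end

lemma (in presburger) multiplication_base:
  "multiplication D z u f (\<lambda>a q y. a = z \<and> y = z \<or> a = u \<and> y = q)"
proof -
  have "u \<noteq> z" using succ[OF z] zero[OF u] comm[OF u z] by auto
  then show ?thesis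
    by unfold_locales (auto simp: z u zero)
qed

lemma psem_pinduction:
  assumes "pfree_for (Add (Var x) One) x \<phi>"
  shows "psem D z u f R e (pinduction x \<phi>) \<longleftrightarrow>
    (psem D z u f R (e(x := z)) \<phi> \<and>
     (\<forall>d\<in>D. psem D z u f R (e(x := d)) \<phi> \<longrightarrow> psem D z u f R (e(x := f d u)) \<phi>) \<longrightarrow>
     (\<forall>d\<in>D. psem D z u f R (e(x := d)) \<phi>))"
proof -
  have "pfree_for Zero x \<phi>" by (rule pfree_for_fresh) simp
  then show ?thesis using assms by (simp add: pinduction_def psem_subst)
qed

lemma (in addition_structure) psem_unique_fm:
  assumes "\<And>x. e x \<in> D"
  shows "psem D z u f R e unique_fm \<longleftrightarrow>
    (\<forall>a\<in>D. \<forall>y\<in>D. \<forall>y'\<in>D. step_rel R a (e 10) y \<longrightarrow> step_rel R a (e 10) y' \<longrightarrow> y = y')"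
  unfolding unique_fm_def using assms by (simp add: psem_step_fm)

lemma pfree_for_PAll: "y \<notin> vars_tm t \<Longrightarrow> pfree_for t x \<phi> \<Longrightarrow> pfree_for t x (PAll y \<phi>)"
  by simp

lemma free_for_unique_fm: "pfree_for (Add (Var 10) One) 10 unique_fm"
  by (simp add: unique_fm_def step_fm_def triple_def Let_def pfree_for_PAll del: pfree_for.simps(5))

lemma free_for_division_fm: "pfree_for (Add (Var 1) One) 1 division_fm"
  by (simp add: division_fm_def)

lemma prov_base: "prov (foldr PImp (arith_axioms 0) (mult_theory 0 base_fm))"
proof (rule completeness)
  fix D :: "tm set set" and z u f R and e :: "nat \<Rightarrow> tm set"
  assume "z \<in> D" "u \<in> D" "\<And>a b. a \<in> D \<Longrightarrow> b \<in> D \<Longrightarrow> f a b \<in> D" and e: "\<And>x. e x \<in> D"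
  then interpret addition_structure D z u f by unfold_locales
  have imps: "psem D z u f R e (foldr PImp \<phi>s \<psi>) \<longleftrightarrow>
      ((\<forall>\<phi>\<in>set \<phi>s. psem D z u f R e \<phi>) \<longrightarrow> psem D z u f R e \<psi>)" for \<phi>s \<psi>
    by (induction \<phi>s) auto
  show "psem D z u f R e (foldr PImp (arith_axioms 0) (mult_theory 0 base_fm))"
    unfolding imps mult_theory_def psem_PConj
  proof
    assume ar: "\<forall>\<phi>\<in>set (arith_axioms 0). psem D z u f R e \<phi>"
    then interpret presburger D z u f by (simp add: psem_arith_axioms)
    have "\<forall>\<phi>\<in>set (mult_axioms 0 base_fm). psem D z u f R e \<phi>"
      by (subst psem_mult_axioms[where Q = "\<lambda>a q y. a = z \<and> y = z \<or> a = u \<and> y = q"])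
        (auto simp: base_fm_def e multiplication_base)
    with ar show "\<forall>\<phi>\<in>set (arith_axioms 0 @ mult_axioms 0 base_fm). psem D z u f R e \<phi>" by auto
  qed
qed

lemma psem_mult_theory:
  assumes "addition_structure D z u f" "\<And>x. e x \<in> D" "psem D z u f R e (mult_theory 0 PRel)"
  shows "multiplication D z u f R"
proof -
  interpret addition_structure D z u f by fact
  interpret presburger D z u f
    using assms(3) by (simp add: mult_theory_def psem_PConj ball_Un psem_arith_axioms)
  show ?thesis
    using assms(2,3) psem_mult_axioms[of 0 R PRel R e]
    by (simp add: mult_theory_def psem_PConj ball_Un)
qed

text \<open>The passage from one level to the next, as a single theorem of the calculus. It is read off from
  \<open>multiplication_step\<close> by completeness, without writing a derivation. On the right the variables start
  at 10, beyond those bound in \<open>step_fm 0\<close>; this matches the shift at the next level.\<close>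

lemma prov_step:
  "prov (PImp (mult_theory 0 PRel) (PImp (pinduction 10 unique_fm) (mult_theory 10 (step_fm 0))))"
proof (rule completeness)
  fix D :: "tm set set" and z u f R and e :: "nat \<Rightarrow> tm set"
  assume "z \<in> D" "u \<in> D" "\<And>a b. a \<in> D \<Longrightarrow> b \<in> D \<Longrightarrow> f a b \<in> D" and e: "\<And>x. e x \<in> D"
  then interpret addition_structure D z u f by unfold_locales
  have "psem D z u f R e (mult_theory 10 (step_fm 0))"
    if th: "psem D z u f R e (mult_theory 0 PRel)" and ind: "psem D z u f R e (pinduction 10 unique_fm)"
  proof -
    interpret multiplication D z u f R by (rule psem_mult_theory[OF addition_structure_axioms e th])
    have "psem D z u f R (e(10 := q)) unique_fm \<longleftrightarrow> step_unique_at q" if "q \<in> D" for q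
      unfolding step_unique_at_def using psem_unique_fm[of "e(10 := q)" R] e that by simp
    with ind z u f have "multiplication D z u f (step_rel R)"
      by (intro multiplication_step) (simp add: psem_pinduction[OF free_for_unique_fm])
    moreover have "psem D z u f R e' (step_fm 0 r s t) \<longleftrightarrow>
        step_rel R (val z u f e' r) (val z u f e' s) (val z u f e' t)"
      if "\<And>x. e' x \<in> D" "vars_tm r \<union> vars_tm s \<union> vars_tm t \<subseteq> {10..}" for e' r s t
      using psem_step_fm[of e' r s t 0 R] that by simp
    ultimately have "\<forall>\<phi>\<in>set (mult_axioms 10 (step_fm 0)). psem D z u f R e \<phi>"
      using psem_mult_axioms[of 10 R "step_fm 0" "step_rel R" e] e by blast
    moreover have "\<forall>\<phi>\<in>set (arith_axioms 10). psem D z u f R e \<phi>"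
      using psem_arith_axioms presburger_axioms by blast
    ultimately show ?thesis by (simp add: mult_theory_def psem_PConj ball_Un)
  qed
  then show "psem D z u f R e
      (PImp (mult_theory 0 PRel) (PImp (pinduction 10 unique_fm) (mult_theory 10 (step_fm 0))))"
    by simp
qed

lemma prov_division:
  "prov (PImp (mult_theory 0 PRel) (PImp (pinduction 1 division_fm) (PAll 1 division_fm)))"
proof (rule completeness)
  fix D :: "tm set set" and z u f R and e :: "nat \<Rightarrow> tm set"
  assume "z \<in> D" "u \<in> D" "\<And>a b. a \<in> D \<Longrightarrow> b \<in> D \<Longrightarrow> f a b \<in> D" and e: "\<And>x. e x \<in> D"
  then interpret addition_structure D z u f by unfold_locales
  have "psem D z u f R e (PAll 1 division_fm)"
    if th: "psem D z u f R e (mult_theory 0 PRel)" and ind: "psem D z u f R e (pinduction 1 division_fm)"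
  proof -
    interpret multiplication D z u f R by (rule psem_mult_theory[OF addition_structure_axioms e th])
    have "psem D z u f R (e(1 := x)) division_fm \<longleftrightarrow> divides x" for x
      by (simp add: division_fm_def divides_def)
    with ind division show ?thesis
      unfolding psem_pinduction[OF free_for_division_fm] psem.simps by blast
  qed
  then show "psem D z u f R e
      (PImp (mult_theory 0 PRel) (PImp (pinduction 1 division_fm) (PAll 1 division_fm)))"
    by simp
qed

section \<open>Short proofs in PrA\<close>

text \<open>Level \<open>n\<close> binds the variables below \<open>10 n\<close>. Since \<open>base_fm\<close> does not contain the relation symbol, the
  formula substituted at level 0 is arbitrary.\<close>

primrec mult_fm :: "nat \<Rightarrow> tm \<Rightarrow> tm \<Rightarrow> tm \<Rightarrow> fm" where
  "mult_fm 0 = (\<lambda>a q y. tr 0 (\<lambda>_ _ _. Eq Zero Zero) (base_fm a q y))"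
| "mult_fm (Suc n) = (\<lambda>a q y. tr 0 (mult_fm n) (step_fm (10 * n) a q y))"

lemma shift_0 [simp]: "shift 0 t = t"
  by (induction t) auto

lemma bound_vars_mult_fm: "bound_vars (mult_fm n a q y) \<subseteq> {..<10 * n}"
proof (induction n arbitrary: a q y)
  case (Suc n)
  have "bound_vars (mult_fm (Suc n) a q y) \<subseteq>
      {10 * n..<10 * n + 10} \<union> bound_vars (mult_fm n (Var (10 * n + 7)) (Var (10 * n + 8)) (Var (10 * n + 9)))"
    by (auto simp: step_fm_def triple_def Let_def)
  also have "\<dots> \<subseteq> {10 * n..<10 * n + 10} \<union> {..<10 * n}" using Suc by blast
  also have "\<dots> \<subseteq> {..<10 * Suc n}" by auto
  finally show ?case .
qed (simp add: base_fm_def)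

lemma free_vars_mult_fm:
  "vars_tm a \<union> vars_tm q \<union> vars_tm y \<subseteq> {10 * n..} \<Longrightarrow>
    free_vars (mult_fm n a q y) \<subseteq> vars_tm a \<union> vars_tm q \<union> vars_tm y"
proof (induction n arbitrary: a q y)
  case (Suc n)
  have "free_vars (mult_fm n (Var (10 * n + 7)) (Var (10 * n + 8)) (Var (10 * n + 9)))
      \<subseteq> {10 * n + 7, 10 * n + 8, 10 * n + 9}"
    using Suc.IH[of "Var (10 * n + 7)" "Var (10 * n + 8)" "Var (10 * n + 9)"] by auto
  then show ?case
    by (auto simp: step_fm_def triple_def Let_def)
qed (auto simp: base_fm_def)

lemma subst_mult_fm: "10 * n \<le> x \<Longrightarrow>
    subst x t (mult_fm n a q y) = mult_fm n (subst_tm x t a) (subst_tm x t q) (subst_tm x t y)"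
proof (induction n arbitrary: a q y)
  case (Suc n)
  then show ?case by (simp add: step_fm_def triple_def Let_def)
qed (simp add: base_fm_def)

text \<open>Each level adds a bounded number of variables, whose indices are below \<open>10 (n + 1)\<close>. The
  factor 2 for the arguments does not accumulate, since the inner formula is applied to variables. The
  constant 1000 is generous.\<close>

lemma length_mult_fm:
  "fm_length (mult_fm n a q y) \<le> 2 * (tm_length a + tm_length q + tm_length y) + 1000 * (n + 1)\<^sup>2"
proof (induction n arbitrary: a q y)
  case (Suc n)
  have b: "length (binary (10 * n + i)) \<le> 10 * n + 10" if "i \<le> 9" for i
    using length_binary[of "10 * n + i"] that by simp
  have b0: "length (binary (10 * n)) \<le> 10 * n + 10" "length (binary (Suc (10 * n))) \<le> 10 * n + 10"
    "length (binary (Suc (Suc (10 * n)))) \<le> 10 * n + 10"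
    using b[of 0] b[of 1] b[of 2] by simp_all
  have "fm_length (mult_fm n (Var (10 * n + 7)) (Var (10 * n + 8)) (Var (10 * n + 9)))
      \<le> 6 * (10 * n + 11) + 1000 * (n + 1)\<^sup>2"
    using Suc[of "Var (10 * n + 7)" "Var (10 * n + 8)" "Var (10 * n + 9)"] b[of 7] b[of 8] b[of 9]
    by simp
  then have "fm_length (mult_fm (Suc n) a q y) \<le> 2 * (tm_length a + tm_length q + tm_length y)
      + (6 * (10 * n + 11) + 1000 * (n + 1)\<^sup>2) + 60 * (10 * n + 10) + 800"
    using b0 b[of 3] b[of 4] b[of 5] b[of 6] b[of 7] b[of 8] b[of 9]
    by (simp add: step_fm_def triple_def Let_def fm_length_def)
  also have "\<dots> \<le> 2 * (tm_length a + tm_length q + tm_length y) + 1000 * (Suc n + 1)\<^sup>2"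
    by (simp add: power2_eq_square algebra_simps)
  finally show ?case .
qed (simp add: base_fm_def fm_length_def)

text \<open>The additive bound of \<open>length_mult_fm\<close> becomes a multiplicative one, as the arguments have
  positive length.\<close>

lemma admissible_mult_fm: "admissible (10 * n) (1002 * (n + 1)\<^sup>2) (mult_fm n)"
proof -
  have "10 * n + 1 \<le> 1002 * (n + 1)\<^sup>2"
    by (simp add: power2_eq_square algebra_simps)
  moreover have "fm_length (mult_fm n r s t) \<le> 1002 * (n + 1)\<^sup>2 * (tm_length r + tm_length s + tm_length t)" for r s t
  proof -
    let ?S = "tm_length r + tm_length s + tm_length t"
    have "1 \<le> ?S" using tm_length_pos[of r] by linarith
    have "fm_length (mult_fm n r s t) \<le> 2 * 1 * ?S + 1000 * (n + 1)\<^sup>2 * 1"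
      using length_mult_fm[of n r s t] by simp
    also have "\<dots> \<le> 2 * (n + 1)\<^sup>2 * ?S + 1000 * (n + 1)\<^sup>2 * ?S"
      using \<open>1 \<le> ?S\<close> by (intro add_mono mult_mono) auto
    finally show ?thesis by (simp add: algebra_simps)
  qed
  ultimately show ?thesis
    unfolding admissible_def using bound_vars_mult_fm free_vars_mult_fm subst_mult_fm by blast
qed

lemma tr_step_fm:
  "tr (10 * n) (mult_fm n) (step_fm 0 r s t) =
    mult_fm (Suc n) (shift (10 * n) r) (shift (10 * n) s) (shift (10 * n) t)"
  by (simp add: step_fm_def triple_def Let_def add.commute)

text \<open>What a step proves at level \<open>n\<close> is literally what the next step assumes.\<close>

lemma tr_mult_theory_step:
  "tr (10 * n) (mult_fm n) (mult_theory 10 (step_fm 0)) = tr (10 * Suc n) (mult_fm (Suc n)) (mult_theory 0 PRel)"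
  by (simp add: mult_theory_def mult_axioms_def arith_axioms_def Let_def tr_step_fm add.commute
      del: mult_fm.simps)

lemma tr_mult_theory_base:
  "tr 0 (mult_fm 0) (mult_theory 0 base_fm) = tr 0 (mult_fm 0) (mult_theory 0 PRel)"
  by (simp add: mult_theory_def mult_axioms_def arith_axioms_def Let_def base_fm_def)

lemma tr_arith_axioms: "\<phi> \<in> set (arith_axioms 0) \<Longrightarrow> tr 0 M \<phi> \<in> PrA_minus"
  by (auto simp: arith_axioms_def PrA_minus_def Let_def le_fm_def)

lemma tr_pinduction:
  "admissible k w M \<Longrightarrow> tr k M (pinduction x \<phi>) = induction_axiom (x + k) (tr k M \<phi>)"
  by (simp add: pinduction_def induction_axiom_def tr_psubst)

lemma provable_within_imps: "provable_within T L (foldr Imp \<phi>s \<psi>) \<Longrightarrow> set \<phi>s \<subseteq> T \<Longrightarrow> \<exists>L. provable_within T L \<psi>"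
proof (induction \<phi>s arbitrary: L)
  case (Cons \<phi> \<phi>s)
  then show ?case using provable_within_mp[OF _ provable_within_axiom, of T L \<phi> "foldr Imp \<phi>s \<psi>"] by auto
qed auto

lemma provable_within_mult_theory_base: "\<exists>L. provable_within PrA L (tr 0 (mult_fm 0) (mult_theory 0 PRel))"
proof -
  have imps: "tr 0 M (foldr PImp \<phi>s \<psi>) = foldr Imp (map (tr 0 M) \<phi>s) (tr 0 M \<psi>)" for M \<phi>s \<psi>
    by (induction \<phi>s) auto
  obtain C where C: "\<And>k w M T. admissible k w M \<Longrightarrow>
      provable_within T (C * w\<^sup>2) (tr k M (foldr PImp (arith_axioms 0) (mult_theory 0 base_fm)))"
    using translate[OF prov_base] by blast
  have "admissible 0 1002 (mult_fm 0)"
    using admissible_mult_fm[of 0] by (simp del: mult_fm.simps)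
  from C[OF this] have "provable_within PrA (C * 1002\<^sup>2)
      (foldr Imp (map (tr 0 (mult_fm 0)) (arith_axioms 0)) (tr 0 (mult_fm 0) (mult_theory 0 base_fm)))"
    unfolding imps .
  then have "\<exists>L. provable_within PrA L (tr 0 (mult_fm 0) (mult_theory 0 base_fm))"
    by (rule provable_within_imps) (auto simp: PrA_def tr_arith_axioms)
  then show ?thesis unfolding tr_mult_theory_base .
qed

text \<open>Instances of induction translate to instances of induction, so they cost one line each.\<close>

lemma provable_within_by_induction:
  assumes "prov (PImp \<chi> (PImp (pinduction x \<phi>) \<psi>))"
  shows "\<exists>C. \<forall>k w M L. admissible k w M \<longrightarrow> provable_within PrA L (tr k M \<chi>) \<longrightarrow> provable_within PrA (L + C * w\<^sup>2) (tr k M \<psi>)"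
proof -
  obtain C where C: "\<And>k w M T. admissible k w M \<Longrightarrow>
      provable_within T (C * w\<^sup>2) (tr k M (PImp \<chi> (PImp (pinduction x \<phi>) \<psi>)))"
    using translate[OF assms] by blast
  obtain A where A: "\<And>k w M. admissible k w M \<Longrightarrow> fm_length (tr k M (PImp (pinduction x \<phi>) \<psi>)) \<le> A * w\<^sup>2"
    using fm_length_tr by blast
  obtain B where B: "\<And>k w M. admissible k w M \<Longrightarrow> fm_length (tr k M (pinduction x \<phi>)) \<le> B * w\<^sup>2"
    using fm_length_tr by blast
  obtain E where E: "\<And>k w M. admissible k w M \<Longrightarrow> fm_length (tr k M \<psi>) \<le> E * w\<^sup>2"
    using fm_length_tr by blast
  have "provable_within PrA (L + (C + A + B + E + 3) * w\<^sup>2) (tr k M \<psi>)"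
    if a: "admissible k w M" and L: "provable_within PrA L (tr k M \<chi>)" for k w M L
  proof -
    have "1 \<le> w\<^sup>2" using a by (simp add: admissible_def)
    have "tr k M (pinduction x \<phi>) \<in> PrA" using tr_pinduction[OF a] by (auto simp: PrA_def)
    then have ind: "provable_within PrA (fm_length (tr k M (pinduction x \<phi>)) + 1) (tr k M (pinduction x \<phi>))"
      by (intro provable_within_axiom) blast
    have "provable_within PrA (C * w\<^sup>2 + L + fm_length (tr k M (PImp (pinduction x \<phi>) \<psi>)) + 1)
        (Imp (tr k M (pinduction x \<phi>)) (tr k M \<psi>))"
      using provable_within_mp[OF _ L, of "C * w\<^sup>2" "tr k M (PImp (pinduction x \<phi>) \<psi>)"] C[OF a] by simp
    from provable_within_mp[OF this ind] show ?thesis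
      by (rule provable_within_mono) (use A[OF a] B[OF a] E[OF a] \<open>1 \<le> w\<^sup>2\<close> in \<open>simp add: algebra_simps\<close>)
  qed
  then show ?thesis by blast
qed

definition speedup_fm :: "nat \<Rightarrow> fm" where
  "speedup_fm n = tr (10 * n) (mult_fm n) (PAll 1 division_fm)"

lemma sentence_speedup_fm: "sentence (speedup_fm n)"
proof -
  have "(\<lambda>x. x + 10 * n) ` pfree_vars (PAll 1 division_fm) = {}" by (auto simp: division_fm_def)
  then show ?thesis
    using free_vars_tr[OF admissible_mult_fm[of n], of "PAll 1 division_fm"]
    unfolding sentence_def speedup_fm_def by blast
qed

lemma length_speedup_fm: "\<exists>C. \<forall>n. fm_length (speedup_fm n) \<le> C * (n + 1) ^ 4"
proof -
  obtain C where C: "\<And>k w M. admissible k w M \<Longrightarrow> fm_length (tr k M (PAll 1 division_fm)) \<le> C * w\<^sup>2"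
    using fm_length_tr by blast
  have "fm_length (speedup_fm n) \<le> (C * 1002\<^sup>2) * (n + 1) ^ 4" for n
    using C[OF admissible_mult_fm[of n]]
    by (simp add: speedup_fm_def power_mult_distrib mult.assoc flip: power_mult del: tr.simps One_nat_def)
  then show ?thesis by blast
qed

text \<open>The proofs of the \<open>n\<close> steps, each of length \<open>O(n ^ 4)\<close>, are concatenated; each uses the result of the
  preceding one only once.\<close>

lemma speedup_fm_short_proof: "\<exists>C. \<forall>n. provable_within PrA (C * (n + 1) ^ 5) (speedup_fm n)"
proof -
  let ?w = "\<lambda>n::nat. 1002 * (n + 1)\<^sup>2" and ?th = "\<lambda>n. tr (10 * n) (mult_fm n) (mult_theory 0 PRel)"
  obtain A where A: "provable_within PrA A (?th 0)" using provable_within_mult_theory_base by auto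
  obtain B where B: "\<And>k w M L. admissible k w M \<Longrightarrow> provable_within PrA L (tr k M (mult_theory 0 PRel)) \<Longrightarrow>
      provable_within PrA (L + B * w\<^sup>2) (tr k M (mult_theory 10 (step_fm 0)))"
    using provable_within_by_induction[OF prov_step] by blast
  obtain C where C: "\<And>k w M L. admissible k w M \<Longrightarrow> provable_within PrA L (tr k M (mult_theory 0 PRel)) \<Longrightarrow>
      provable_within PrA (L + C * w\<^sup>2) (tr k M (PAll 1 division_fm))"
    using provable_within_by_induction[OF prov_division] by blast
  have th: "provable_within PrA (A + n * (B * (?w n)\<^sup>2)) (?th n)" for n
  proof (induction n)
    case (Suc n)
    have "provable_within PrA (A + n * (B * (?w n)\<^sup>2) + B * (?w n)\<^sup>2) (?th (Suc n))"
      using B[OF admissible_mult_fm Suc] unfolding tr_mult_theory_step .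
    moreover have "(?w n)\<^sup>2 \<le> (?w (Suc n))\<^sup>2" by (intro power_mono mult_left_mono) auto
    then have "Suc n * (B * (?w n)\<^sup>2) \<le> Suc n * (B * (?w (Suc n))\<^sup>2)" by (intro mult_left_mono) auto
    ultimately show ?case by (elim provable_within_mono) simp
  qed (use A in simp)
  have "provable_within PrA ((A + (B + C) * 1002\<^sup>2) * (n + 1) ^ 5) (speedup_fm n)" for n
  proof -
    have w: "(?w n)\<^sup>2 = 1002\<^sup>2 * (n + 1) ^ 4"
      by (simp add: power_mult_distrib flip: power_mult)
    have p: "(n + 1) ^ 5 = (n + 1) * (n + 1) ^ 4" by (simp add: eval_nat_numeral)
    have "provable_within PrA (A + n * (B * (?w n)\<^sup>2) + C * (?w n)\<^sup>2) (speedup_fm n)"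
      unfolding speedup_fm_def by (rule C[OF admissible_mult_fm th])
    moreover have "A + n * (B * (?w n)\<^sup>2) + C * (?w n)\<^sup>2 \<le> (A + (B + C) * 1002\<^sup>2) * (n + 1) ^ 5"
    proof -
      have "A * 1 \<le> A * (n + 1) ^ 5" by (intro mult_left_mono) auto
      moreover have "n * (B * (?w n)\<^sup>2) \<le> B * 1002\<^sup>2 * (n + 1) ^ 5"
        unfolding w p by (simp add: algebra_simps)
      moreover have "C * (?w n)\<^sup>2 \<le> C * 1002\<^sup>2 * (n + 1) ^ 5"
        unfolding w p by (simp add: algebra_simps)
      ultimately show ?thesis by (simp only: distrib_right)
    qed
    ultimately show ?thesis by (rule provable_within_mono)
  qed
  then show ?thesis by blast
qed

section \<open>Soundness and the meaning of the formulas\<close>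

text \<open>The semantics of arithmetical formulas is inherited from the extended language, together with its
  substitution lemma.\<close>

fun embed :: "fm \<Rightarrow> pfm" where
  "embed (Eq s t) = PEq s t"
| "embed (Neg \<phi>) = PNeg (embed \<phi>)"
| "embed (Imp \<phi> \<psi>) = PImp (embed \<phi>) (embed \<psi>)"
| "embed (Forall x \<phi>) = PAll x (embed \<phi>)"

abbreviation sem :: "'a set \<Rightarrow> 'a \<Rightarrow> 'a \<Rightarrow> ('a \<Rightarrow> 'a \<Rightarrow> 'a) \<Rightarrow> (nat \<Rightarrow> 'a) \<Rightarrow> fm \<Rightarrow> bool" where
  "sem D z u f e \<phi> \<equiv> psem D z u f (\<lambda>_ _ _. False) e (embed \<phi>)"

lemma pfree_vars_embed: "pfree_vars (embed \<phi>) = free_vars \<phi>"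
  by (induction \<phi>) auto

lemma embed_subst: "embed (subst x t \<phi>) = psubst x t (embed \<phi>)"
  by (induction \<phi>) auto

lemma pfree_for_embed: "pfree_for t x (embed \<phi>) = free_for t x \<phi>"
  by (induction \<phi>) (auto simp: pfree_vars_embed)

context addition_structure
begin

lemma sem_logical_axiom:
  assumes "logical_axiom \<phi>" and e: "\<And>x. e x \<in> D"
  shows "sem D z u f e \<phi>"
  using assms(1)
proof cases
  case (4 t x \<phi>)
  then show ?thesis using val_in[of e t] e
    by (simp add: embed_subst psem_subst pfree_for_embed)
next
  case (5 x \<phi> \<psi>)
  have "psem D z u f R (e(x := d)) (embed \<phi>) = psem D z u f R e (embed \<phi>)" for R d
    by (rule psem_cong) (use 5 in \<open>auto simp: pfree_vars_embed\<close>)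
  then show ?thesis using 5 by simp
next
  case (7 s x \<phi> t)
  then show ?thesis by (simp add: embed_subst psem_subst pfree_for_embed)
qed auto

lemma sound:
  assumes "proof_in T \<pi>" and T: "\<And>\<phi> e. \<phi> \<in> T \<Longrightarrow> (\<And>x. e x \<in> D) \<Longrightarrow> sem D z u f e \<phi>"
    and "i < length \<pi>" "\<And>x. e x \<in> D"
  shows "sem D z u f e (\<pi> ! i)"
  using assms(3,4)
proof (induction i arbitrary: e rule: less_induct)
  case (less i)
  from assms(1) less.prems(1) consider "logical_axiom (\<pi> ! i)" | "\<pi> ! i \<in> T"
    | j k where "j < i" "k < i" "\<pi> ! k = Imp (\<pi> ! j) (\<pi> ! i)"
    | j x where "j < i" "\<pi> ! i = Forall x (\<pi> ! j)"
    unfolding proof_in_def by blast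
  then show ?case
  proof cases
    case 1
    then show ?thesis using sem_logical_axiom less.prems(2) by blast
  next
    case 2
    then show ?thesis using T less.prems(2) by blast
  next
    case (3 j k)
    then have "sem D z u f e (\<pi> ! j)" "sem D z u f e (\<pi> ! k)"
      using less.IH[of j e] less.IH[of k e] less.prems by simp_all
    then show ?thesis using 3 by simp
  next
    case (4 j x)
    have "sem D z u f (e(x := d)) (\<pi> ! j)" if "d \<in> D" for d
    proof (rule less.IH[OF 4(1)])
      show "j < length \<pi>" using 4(1) less.prems(1) by simp
      show "(e(x := d)) y \<in> D" for y using that less.prems(2) by simp
    qed
    then show ?thesis using 4 by simp
  qed
qed

lemma val_shift: "val z u f e (shift k t) = val z u f (\<lambda>x. e (x + k)) t"
  by (induction t) auto

lemma sem_tr: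
  assumes "\<And>e r s t. (\<And>x. e x \<in> D) \<Longrightarrow> vars_tm r \<union> vars_tm s \<union> vars_tm t \<subseteq> {k..} \<Longrightarrow>
      sem D z u f e (M r s t) \<longleftrightarrow> R (val z u f e r) (val z u f e s) (val z u f e t)"
    and "\<And>x. e x \<in> D"
  shows "sem D z u f e (tr k M \<phi>) \<longleftrightarrow> psem D z u f R (\<lambda>x. e (x + k)) \<phi>"
  using assms(2)
proof (induction \<phi> arbitrary: e)
  case (PRel r s t)
  have "vars_tm (shift k r) \<union> vars_tm (shift k s) \<union> vars_tm (shift k t) \<subseteq> {k..}"
    by (auto simp: vars_shift)
  with assms(1)[of e, OF PRel] show ?case by (simp add: val_shift)
next
  case (PAll x \<phi>)
  have "(\<lambda>y. (e(x + k := d)) (y + k)) = (\<lambda>y. e (y + k))(x := d)" for d by auto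
  moreover have "sem D z u f (e(x + k := d)) (tr k M \<phi>) \<longleftrightarrow>
      psem D z u f R (\<lambda>y. (e(x + k := d)) (y + k)) \<phi>" if "d \<in> D" for d
    by (rule PAll.IH) (simp add: PAll.prems that)
  ultimately show ?case by simp
qed (simp_all add: val_shift)

definition base_rel :: "'a \<Rightarrow> 'a \<Rightarrow> 'a \<Rightarrow> bool" where
  "base_rel a q y \<longleftrightarrow> a = z \<and> y = z \<or> a = u \<and> y = q"

lemma unshift: "vars_tm t \<subseteq> {m + k..} \<Longrightarrow> \<exists>s. t = shift k s \<and> vars_tm s \<subseteq> {m..}"
proof (induction t)
  case (Var x)
  then show ?case by (intro exI[of _ "Var (x - k)"]) auto
next
  case (Add s t)
  then obtain s' t' where "s = shift k s'" "vars_tm s' \<subseteq> {m..}" "t = shift k t'" "vars_tm t' \<subseteq> {m..}"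
    by auto
  then show ?case by (intro exI[of _ "Add s' t'"]) auto
next
  case Zero
  show ?case by (intro exI[of _ Zero]) auto
next
  case One
  show ?case by (intro exI[of _ One]) auto
qed

lemma sem_mult_fm:
  "(\<And>x. e x \<in> D) \<Longrightarrow> vars_tm a \<union> vars_tm q \<union> vars_tm y \<subseteq> {10 * n..} \<Longrightarrow>
    sem D z u f e (mult_fm n a q y) \<longleftrightarrow>
      (step_rel ^^ n) base_rel (val z u f e a) (val z u f e q) (val z u f e y)"
proof (induction n arbitrary: e a q y)
  case 0
  show ?case by (auto simp: base_fm_def base_rel_def)
next
  case (Suc n)
  from Suc.prems(2) unshift[of a 10 "10 * n"] unshift[of q 10 "10 * n"] unshift[of y 10 "10 * n"]
  obtain a' q' y' where *: "a = shift (10 * n) a'" "q = shift (10 * n) q'" "y = shift (10 * n) y'"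
    "vars_tm a' \<union> vars_tm q' \<union> vars_tm y' \<subseteq> {10..}"
    by auto
  have "sem D z u f e (mult_fm (Suc n) a q y) \<longleftrightarrow>
      sem D z u f e (tr (10 * n) (mult_fm n) (step_fm 0 a' q' y'))"
    unfolding tr_step_fm * ..
  also have "\<dots> \<longleftrightarrow> psem D z u f ((step_rel ^^ n) base_rel) (\<lambda>x. e (x + 10 * n)) (step_fm 0 a' q' y')"
    by (rule sem_tr) (use Suc in auto)
  also have "\<dots> \<longleftrightarrow> (step_rel ^^ Suc n) base_rel (val z u f e a) (val z u f e q) (val z u f e y)"
    using psem_step_fm[of "\<lambda>x. e (x + 10 * n)" a' q' y' 0] * Suc.prems(1) by (simp add: val_shift)
  finally show ?case .
qed

lemma sem_speedup_fm:
  assumes "\<And>x. e x \<in> D"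
  shows "sem D z u f e (speedup_fm n) \<longleftrightarrow>
    psem D z u f ((step_rel ^^ n) base_rel) (\<lambda>x. e (x + 10 * n)) (PAll 1 division_fm)"
  unfolding speedup_fm_def by (rule sem_tr) (use sem_mult_fm assms in auto)

lemma sem_Disj: "sem D z u f e (Disj \<phi>s) \<longleftrightarrow> (\<exists>\<phi>\<in>set \<phi>s. sem D z u f e \<phi>)"
  by (induction \<phi>s rule: Disj.induct) auto

end

lemma PrA_minus_embed: "\<phi> \<in> PrA_minus \<Longrightarrow> embed \<phi> \<in> set (arith_axioms 0)"
  by (auto simp: PrA_minus_def arith_axioms_def Let_def le_fm_def)

section \<open>A model with division by small primes only\<close>

text \<open>The localization of the integers in which the primes below \<open>N\<close>, and no others, become invertible.\<close>

definition smooth_rat :: "nat \<Rightarrow> rat \<Rightarrow> bool" where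
  "smooth_rat N r \<longleftrightarrow> (\<exists>m>0. (\<forall>p. prime p \<longrightarrow> p dvd m \<longrightarrow> p < N) \<and> of_nat m * r \<in> \<int>)"

lemma smooth_rat_add: assumes "smooth_rat N r" "smooth_rat N s" shows "smooth_rat N (r + s)"
proof -
  obtain m n where *: "m > 0" "\<And>p. prime p \<Longrightarrow> p dvd m \<Longrightarrow> p < N" "of_nat m * r \<in> \<int>"
    "n > 0" "\<And>p. prime p \<Longrightarrow> p dvd n \<Longrightarrow> p < N" "of_nat n * s \<in> \<int>"
    using assms unfolding smooth_rat_def by blast
  have "of_nat (m * n) * (r + s) = of_nat n * (of_nat m * r) + of_nat m * (of_nat n * s)"
    by (simp add: algebra_simps)
  also have "\<dots> \<in> \<int>" using * by simp
  finally show ?thesis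
    unfolding smooth_rat_def using * by (intro exI[of _ "m * n"]) (auto simp: prime_dvd_mult_iff)
qed

lemma smooth_rat_uminus: "smooth_rat N r \<Longrightarrow> smooth_rat N (- r)"
  unfolding smooth_rat_def by auto

lemma smooth_rat_int: "r \<in> \<int> \<Longrightarrow> smooth_rat N r"
  unfolding smooth_rat_def by (intro exI[of _ 1]) auto

lemma smooth_rat_mult: assumes "smooth_rat N r" shows "smooth_rat N (of_nat k * r)"
proof -
  obtain m where *: "m > 0" "\<And>p. prime p \<Longrightarrow> p dvd m \<Longrightarrow> p < N" "of_nat m * r \<in> \<int>"
    using assms unfolding smooth_rat_def by blast
  have "of_nat m * (of_nat k * r) = of_nat k * (of_nat m * r)" by (simp add: algebra_simps)
  also have "\<dots> \<in> \<int>" using * by simp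
  finally show ?thesis unfolding smooth_rat_def using * by blast
qed

lemma smooth_rat_divide:
  assumes "smooth_rat N r" "prime p" "p < N"
  shows "smooth_rat N (r / of_nat p)"
proof -
  obtain m where *: "m > 0" "\<And>p. prime p \<Longrightarrow> p dvd m \<Longrightarrow> p < N" "of_nat m * r \<in> \<int>"
    using assms unfolding smooth_rat_def by blast
  have "p > 0" using assms(2) prime_gt_0_nat by blast
  then have "of_nat (m * p) * (r / of_nat p) = of_nat m * r" by simp
  with *(3) have "of_nat (m * p) * (r / of_nat p) \<in> \<int>" by simp
  moreover have "q < N" if "prime q" "q dvd m * p" for q
  proof -
    from that have "q dvd m \<or> q dvd p" by (simp add: prime_dvd_mult_iff)
    then show ?thesis using *(2)[OF that(1)] primes_dvd_imp_eq[OF that(1) assms(2)] assms(3) by auto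
  qed
  moreover have "m * p > 0" using *(1) \<open>p > 0\<close> by simp
  ultimately show ?thesis unfolding smooth_rat_def by (intro exI[of _ "m * p"] conjI allI impI)
qed

lemma not_smooth_rat: assumes "prime p" "p \<ge> N" shows "\<not> smooth_rat N (1 / of_nat p)"
proof
  assume "smooth_rat N (1 / of_nat p)"
  then obtain m k where m: "m > 0" "\<And>p. prime p \<Longrightarrow> p dvd m \<Longrightarrow> p < N" "of_nat m / of_nat p = (of_int k :: rat)"
    unfolding smooth_rat_def by (auto elim: Ints_cases)
  have "p > 0" using assms(1) prime_gt_0_nat by blast
  then have "(of_int (int m) :: rat) = of_int (k * int p)" using m(3) by (simp add: field_simps)
  then have "int m = k * int p" by (simp only: of_int_eq_iff)
  then have "int p dvd int m" by simp
  then have "p dvd m" by simp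
  with m(2)[OF assms(1)] assms(2) show False by simp
qed

text \<open>The nonnegative part of the lexicographic product of these rationals with the integers. The standard
  numbers are the pairs \<open>(0, k)\<close>. A pair \<open>(r, k)\<close> with \<open>r > 0\<close> is infinite, and dividing it by a prime
  \<open>p\<close> with a standard remainder requires \<open>r / p\<close> to be available.\<close>

definition model :: "nat \<Rightarrow> (rat \<times> int) set" where
  "model N = {(r, k). smooth_rat N r \<and> (r > 0 \<or> r = 0 \<and> k \<ge> 0)}"

definition padd :: "rat \<times> int \<Rightarrow> rat \<times> int \<Rightarrow> rat \<times> int" where
  "padd a b = (fst a + fst b, snd a + snd b)"

definition pmul :: "nat \<Rightarrow> rat \<times> int \<Rightarrow> rat \<times> int" where
  "pmul m a = (of_nat m * fst a, of_nat m * snd a)"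

lemma presburger_model: "presburger (model N) (0, 0) (0, 1) padd"
proof
  show "(0, 0) \<in> model N" "(0, 1) \<in> model N" by (auto simp: model_def smooth_rat_int)
  show "padd a b \<in> model N" if "a \<in> model N" "b \<in> model N" for a b
    using that by (auto simp: model_def padd_def smooth_rat_add)
  show "padd a (0, 1) \<noteq> (0, 0)" if "a \<in> model N" for a
    using that by (auto simp: model_def padd_def)
  show "\<exists>b\<in>model N. a = padd b (0, 1)" if "a \<in> model N" "a \<noteq> (0, 0)" for a
    using that by (intro bexI[of _ "(fst a, snd a - 1)"]) (auto simp: model_def padd_def)
  show "(\<exists>c\<in>model N. padd a c = b) \<or> (\<exists>c\<in>model N. padd b c = a)" if "a \<in> model N" "b \<in> model N" for a b
  proof -
    define c where "c = (fst b - fst a, snd b - snd a)"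
    define d where "d = (fst a - fst b, snd a - snd b)"
    have "smooth_rat N (fst b - fst a)" "smooth_rat N (fst a - fst b)"
      using that smooth_rat_add[OF _ smooth_rat_uminus, of N "fst b" "fst a"]
        smooth_rat_add[OF _ smooth_rat_uminus, of N "fst a" "fst b"] by (auto simp: model_def)
    then have "c \<in> model N \<or> d \<in> model N"
      unfolding c_def d_def model_def by auto
    moreover have "padd a c = b" "padd b d = a" by (auto simp: padd_def c_def d_def)
    ultimately show ?thesis by blast
  qed
qed (auto simp: padd_def)

lemma pmul_model: "a \<in> model N \<Longrightarrow> pmul m a \<in> model N"
  by (cases "m = 0") (auto simp: model_def pmul_def smooth_rat_mult smooth_rat_int)

lemma numeral_model: "(0, int m) \<in> model N"
  by (auto simp: model_def smooth_rat_int)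

lemma val_mult_tm: "val (0, 0) (0, 1) padd e (mult_tm n t) = pmul n (val (0, 0) (0, 1) padd e t)"
  by (induction n t rule: mult_tm.induct) (auto simp: pmul_def padd_def algebra_simps)

lemma val_numeral_tm: "val (0, 0) (0, 1) padd e (numeral_tm n) = (0, int n)"
  by (simp add: numeral_tm_def val_mult_tm pmul_def)

text \<open>The first component is divided exactly, the second one with remainder.\<close>

lemma sem_mod_axiom:
  assumes p: "prime p" "p < N"
  shows "sem (model N) (0, 0) (0, 1) padd e (mod_axiom p)"
proof -
  interpret presburger "model N" "(0, 0)" "(0, 1)" padd by (rule presburger_model)
  have "p > 0" using p prime_gt_0_nat by blast
  have "\<exists>r\<in>{0..<p}. sem (model N) (0, 0) (0, 1) padd (e(0 := x)) (cong_fm 1 p (Var 0) (numeral_tm r))"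
    if x: "x \<in> model N" for x
  proof -
    obtain s k where sk: "x = (s, k)" by force
    define c where "c = (s / of_nat p, k div int p)"
    have c: "c \<in> model N"
      using x p \<open>p > 0\<close> by (auto simp: sk c_def model_def smooth_rat_divide pos_imp_zdiv_nonneg_iff)
    have "int (nat (k mod int p)) = k mod int p" using \<open>p > 0\<close> by simp
    then have "padd (pmul p c) (0, int (nat (k mod int p))) = x"
      using \<open>p > 0\<close> by (simp add: padd_def pmul_def c_def sk)
    then have "sem (model N) (0, 0) (0, 1) padd (e(0 := x)) (cong_fm 1 p (Var 0) (numeral_tm (nat (k mod int p))))"
      using c by (auto simp: cong_fm_def val_mult_tm val_numeral_tm)
    moreover have "nat (k mod int p) \<in> {0..<p}" using \<open>p > 0\<close> by (simp add: nat_less_iff)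
    ultimately show ?thesis by blast
  qed
  then show ?thesis
    by (simp add: mod_axiom_def sem_Disj)
qed

text \<open>The standard numbers recognized by the multiplication formula of level \<open>n\<close> in the model.\<close>

primrec reach :: "nat \<Rightarrow> nat set" where
  "reach 0 = {0, 1}"
| "reach (Suc n) = {c * v + w | c v w. c \<in> reach n \<and> v \<in> reach n \<and> w \<in> reach n}"

text \<open>Division with remainder: \<open>m = (m div b) b + m mod b\<close>.\<close>

lemma reach_Suc_interval:
  assumes "{..b} \<subseteq> reach n" "b > 0" shows "{..b * b} \<subseteq> reach (Suc n)"
proof
  fix m assume "m \<in> {..b * b}"
  then have "m div b \<le> b" using assms(2) div_le_mono[of m "b * b" b] by simp
  moreover have "m mod b \<le> b" using assms(2) mod_less_divisor[of b m] by simp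
  moreover have "m = (m div b) * b + m mod b" by simp
  ultimately have "m div b \<in> reach n" "b \<in> reach n" "m mod b \<in> reach n" using assms(1) by auto
  moreover note \<open>m = (m div b) * b + m mod b\<close>
  ultimately show "m \<in> reach (Suc n)" unfolding reach.simps mem_Collect_eq by blast
qed

text \<open>Each level squares the bound, starting from 2 at level 1; at level 0 the bound 1 would never grow.\<close>

lemma reach_interval: "{..2 ^ 2 ^ n} \<subseteq> reach (Suc n)"
proof (induction n)
  case 0
  have "m \<in> reach (Suc 0)" if "m \<le> 2" for m
  proof -
    from that consider "m = 0 * 0 + 0" | "m = 1 * 1 + 0" | "m = 1 * 1 + 1" by fastforce
    then show ?thesis by cases (simp only: reach.simps; blast)+
  qed
  then show ?case by auto
next
  case (Suc n)
  show ?case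
    using reach_Suc_interval[OF Suc] by (simp add: mult_2 power_add del: reach.simps)
qed

text \<open>Only standard numbers are recognized, and on these the relation is true multiplication.\<close>

lemma iterated_step_model:
  fixes N
  defines "St \<equiv> addition_structure.step_rel (model N) padd"
    and "B \<equiv> addition_structure.base_rel (0, 0) (0, 1)"
  assumes "a \<in> model N" "q \<in> model N" "y \<in> model N"
  shows "(St ^^ n) B a q y \<longleftrightarrow> (\<exists>m\<in>reach n. a = (0, int m) \<and> y = pmul m q)"
proof -
  interpret presburger "model N" "(0, 0)" "(0, 1)" padd by (rule presburger_model)
  show ?thesis
    using assms(3-)
  proof (induction n arbitrary: a q y)
    case 0
    then show ?case by (auto simp: B_def base_rel_def pmul_def)
  next
    case (Suc n)
    let ?R = "(St ^^ n) B"
    have "(St ^^ Suc n) B a q y \<longleftrightarrow> step_rel ?R a q y" by (simp add: St_def)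
    also have "\<dots> \<longleftrightarrow> (\<exists>m\<in>reach (Suc n). a = (0, int m) \<and> y = pmul m q)"
    proof
      assume "step_rel ?R a q y"
      then obtain c v w y1 y2 y3 y4 where D: "c \<in> model N" "v \<in> model N" "w \<in> model N"
          "y1 \<in> model N" "y2 \<in> model N" "y3 \<in> model N" "y4 \<in> model N"
        and *: "a = padd y1 w" "y = padd y3 y4" "?R c v y1" "?R v q y2" "?R c y2 y3" "?R w q y4"
        by (rule step_relE)
      obtain i where i: "i \<in> reach n" "c = (0, int i)" "y1 = pmul i v"
        using Suc.IH[OF D(1,2,4)] *(3) by blast
      obtain j where j: "j \<in> reach n" "v = (0, int j)" "y2 = pmul j q"
        using Suc.IH[OF D(2) Suc.prems(2) D(5)] *(4) by blast
      obtain l where l: "l \<in> reach n" "w = (0, int l)" "y4 = pmul l q"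
        using Suc.IH[OF D(3) Suc.prems(2) D(7)] *(6) by blast
      have y3: "y3 = pmul i y2"
        using Suc.IH[OF D(1,5,6)] *(5) i(2) by auto
      have "a = (0, int (i * j + l))" "y = pmul (i * j + l) q"
        using *(1,2) i(3) j(2,3) l(2,3) y3 by (auto simp: padd_def pmul_def algebra_simps)
      moreover have "i * j + l \<in> reach (Suc n)" using i(1) j(1) l(1) by auto
      ultimately show "\<exists>m\<in>reach (Suc n). a = (0, int m) \<and> y = pmul m q" by blast
    next
      assume "\<exists>m\<in>reach (Suc n). a = (0, int m) \<and> y = pmul m q"
      then obtain i j l where *: "i \<in> reach n" "j \<in> reach n" "l \<in> reach n"
        "a = (0, int (i * j + l))" "y = pmul (i * j + l) q" by auto
      have eqs: "a = padd (pmul i (0, int j)) (0, int l)" "y = padd (pmul i (pmul j q)) (pmul l q)"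
        using *(4,5) by (auto simp: padd_def pmul_def algebra_simps)
      show "step_rel ?R a q y"
      proof (rule step_relI)
        show "?R (0, int i) (0, int j) (pmul i (0, int j))"
          using Suc.IH[OF numeral_model[of i] numeral_model[of j] pmul_model[OF numeral_model]] *(1) by blast
        show "?R (0, int j) q (pmul j q)"
          using Suc.IH[OF numeral_model[of j] Suc.prems(2) pmul_model[OF Suc.prems(2)]] *(2) by blast
        show "?R (0, int i) (pmul j q) (pmul i (pmul j q))"
          using Suc.IH[OF numeral_model[of i] pmul_model[OF Suc.prems(2)] pmul_model[OF pmul_model[OF Suc.prems(2)]]] *(1)
          by blast
        show "?R (0, int l) q (pmul l q)"
          using Suc.IH[OF numeral_model[of l] Suc.prems(2) pmul_model[OF Suc.prems(2)]] *(3) by blast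
      qed (use eqs Suc.prems(2) in \<open>simp_all add: numeral_model pmul_model\<close>)
    qed
    finally show ?case .
  qed
qed

text \<open>The infinite element \<open>(1, 0)\<close> would be \<open>P q + r\<close> with \<open>r\<close> below the standard number \<open>P\<close>. Then \<open>r\<close> is
  standard and the first component of \<open>q\<close> is \<open>1 / P\<close>, whose denominator is too large a prime.\<close>

lemma speedup_fm_fails:
  assumes P: "prime P" "P \<ge> N" "P \<in> reach n" and e: "\<And>x. e x \<in> model N"
  shows "\<not> sem (model N) (0, 0) (0, 1) padd e (speedup_fm n)"
proof
  interpret presburger "model N" "(0, 0)" "(0, 1)" padd by (rule presburger_model)
  let ?R = "(step_rel ^^ n) base_rel"
  have "P > 0" using P(1) prime_gt_0_nat by blast
  have a: "(0, int P) \<in> model N" and x: "(1, 0) \<in> model N"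
    by (auto simp: model_def smooth_rat_int)
  have R0: "?R (0, int P) (0, 0) (0, 0)"
    using iterated_step_model[OF a z z, of n] P(3) by (auto simp: pmul_def)
  assume "sem (model N) (0, 0) (0, 1) padd e (speedup_fm n)"
  then have "psem (model N) (0, 0) (0, 1) padd ?R (\<lambda>x. e (x + 10 * n)) (PAll 1 division_fm)"
    by (rule iffD1[OF sem_speedup_fm[of e n, OF e]])
  then have "psem (model N) (0, 0) (0, 1) padd ?R ((\<lambda>x. e (x + 10 * n))(1 := (1, 0), 0 := (0, int P)))
      (PImp (PRel (Var 0) Zero Zero) (PImp (PNeg (PEq (Var 0) Zero))
     (PEx 2 (PEx 3 (PEx 4 (PCon (PRel (Var 0) (Var 2) (Var 3)) (PCon (PEq (Var 1) (Add (Var 3) (Var 4)))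
       (PEx 5 (PEq (Add (Add (Var 4) (Var 5)) One) (Var 0))))))))))"
    unfolding division_fm_def psem.simps(5) using a x by blast
  then obtain q y r s where D: "q \<in> model N" "y \<in> model N" "r \<in> model N" "s \<in> model N"
    and *: "?R (0, int P) q y" "(1, 0) = padd y r" "padd (padd r s) (0, 1) = (0, int P)"
    using R0 \<open>P > 0\<close> by auto
  have "fst r \<ge> 0" "fst s \<ge> 0" using D by (auto simp: model_def)
  with *(3) have "fst r = 0" by (simp add: padd_def)
  moreover have "y = pmul P q"
    using iterated_step_model[OF a D(1,2), of n] *(1) by auto
  ultimately have "1 = of_nat P * fst q" using *(2) by (simp add: padd_def pmul_def)
  then have "fst q = 1 / of_nat P" using \<open>P > 0\<close> by (simp add: field_simps)
  moreover have "smooth_rat N (fst q)" using D(1) by (auto simp: model_def)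
  ultimately show False using not_smooth_rat[OF P(1,2)] by simp
qed

section \<open>Long proofs in the alternative theory\<close>

lemma fm_length_pos: "fm_length \<phi> > 0"
  by (cases \<phi>) (auto simp: fm_length_def)

lemma length_Disj: "length \<phi>s \<le> fm_length (Disj \<phi>s)"
  using fm_length_pos by (induction \<phi>s rule: Disj.induct) (auto simp: fm_length_def Suc_le_eq)

text \<open>The axiom for \<open>p\<close> has \<open>p\<close> disjuncts.\<close>

lemma length_mod_axiom: "p \<le> fm_length (mod_axiom p)"
proof -
  have "p \<le> fm_length (Disj (map (\<lambda>r. cong_fm 1 p (Var 0) (numeral_tm r)) [0..<p]))"
    using length_Disj[of "map (\<lambda>r. cong_fm 1 p (Var 0) (numeral_tm r)) [0..<p]"] by simp
  then show ?thesis by (simp add: mod_axiom_def fm_length_def)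
qed

lemma fm_length_less_proof_length: "\<phi> \<in> set \<pi> \<Longrightarrow> fm_length \<phi> < proof_length \<pi>"
  by (induction \<pi>) (auto simp: fm_length_def proof_length_def write_proof_def)

text \<open>A proof shorter than \<open>N\<close> is too short to contain the axiom for any prime from \<open>N\<close> on. All axioms
  that occur in it hold in the model, and its conclusion does not.\<close>

lemma speedup_fm_long_proof:
  assumes P: "prime P" "P \<ge> N" "P \<in> reach n" and \<pi>: "proves_by PrA_alt \<pi> (speedup_fm n)"
  shows "N \<le> proof_length \<pi>"
proof (rule ccontr)
  interpret presburger "model N" "(0, 0)" "(0, 1)" padd by (rule presburger_model)
  assume short: "\<not> N \<le> proof_length \<pi>"
  have "proof_in (PrA_alt \<inter> set \<pi>) \<pi>"
    using \<pi> unfolding proves_by_def proof_in_def by (metis IntI nth_mem)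
  moreover have "sem (model N) (0, 0) (0, 1) padd e \<phi>"
    if "\<phi> \<in> PrA_alt \<inter> set \<pi>" "\<And>x. e x \<in> model N" for \<phi> e
  proof -
    from that(1) consider "\<phi> \<in> PrA_minus" | p where "prime p" "\<phi> = mod_axiom p"
      unfolding PrA_alt_def by blast
    then show ?thesis
    proof cases
      case 1
      then show ?thesis using psem_arith_axioms[of 0] presburger_axioms PrA_minus_embed by blast
    next
      case (2 p)
      then have "p < N"
        using length_mod_axiom[of p] fm_length_less_proof_length[of \<phi> \<pi>] that(1) short by simp
      then show ?thesis using sem_mod_axiom 2 by blast
    qed
  qed
  moreover have "last \<pi> = \<pi> ! (length \<pi> - 1)" "length \<pi> - 1 < length \<pi>" "last \<pi> = speedup_fm n"
    using \<pi> unfolding proves_by_def by (auto simp: last_conv_nth)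
  ultimately have "sem (model N) (0, 0) (0, 1) padd (\<lambda>_. (0, 0)) (speedup_fm n)"
    using sound[of "PrA_alt \<inter> set \<pi>" \<pi> "length \<pi> - 1" "\<lambda>_. (0, 0)"] z by simp
  then show False using speedup_fm_fails[OF P, of "\<lambda>_. (0, 0)"] z by simp
qed

section \<open>A prime in a polynomially short interval\<close>

text \<open>Leibniz' harmonic triangle: the identity
  \<open>1 / ((k + 1) C(n, k + 1)) = 1 / (k C(n - 1, k)) - 1 / (k C(n, k))\<close> shows by induction on \<open>k\<close> that
  \<open>L / (k C(n, k))\<close> is an integer.\<close>

lemma binomial_dvd_common_multiple:
  fixes n L :: nat
  assumes "1 \<le> k" "k \<le> n" "\<And>i. 1 \<le> i \<Longrightarrow> i \<le> n \<Longrightarrow> i dvd L"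
  shows "k * (n choose k) dvd L"
  using assms
proof (induction k arbitrary: n rule: nat_induct_at_least)
  case base
  then show ?case by simp
next
  case (Suc k)
  from Suc.IH[of n] Suc.prems obtain b where b: "L = k * (n choose k) * b"
    by (metis Suc_leD dvdE)
  have "k * ((n - 1) choose k) dvd L" using Suc.IH[of "n - 1"] Suc.prems by simp
  then obtain a where a: "L = k * ((n - 1) choose k) * a" by (metis dvdE)
  have ab1: "(n - k) * (n choose k) = n * ((n - 1) choose k)" by (rule binomial_absorb_comp)
  have ab2: "Suc k * (n choose Suc k) = n * ((n - 1) choose k)" by (rule binomial_absorption)
  have "k * (n choose k) * (n * b) = n * L" using b by simp
  also have "\<dots> = k * (n * ((n - 1) choose k)) * a" using a by simp
  also have "\<dots> = k * (n choose k) * ((n - k) * a)" unfolding ab1[symmetric] by (simp only: ac_simps)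
  finally have nb: "n * b = (n - k) * a" using Suc.hyps Suc.prems(1) by simp
  have "int ((n - k) * a) = int (n * b)" using nb by simp
  then have "int n * int b = (int n - int k) * int a" using Suc.prems(1) by (simp add: of_nat_diff)
  moreover have "int L = int k * int (n choose k) * int b" using b by simp
  ultimately have "int L = (int n - int k) * int (n choose k) * (int a - int b)" by algebra
  then have "int L = int (Suc k * (n choose Suc k)) * (int a - int b)"
    unfolding ab2 ab1[symmetric] using Suc.prems(1) by (simp add: of_nat_diff)
  then have "int (Suc k * (n choose Suc k)) dvd int L" by simp
  then show ?case by (simp only: int_dvd_int_iff)
qed

text \<open>The least common multiple of the numbers up to \<open>n\<close> is the product of the largest prime powers not
  exceeding \<open>n\<close>, one for each prime.\<close>

lemma small_common_multiple:
  fixes n :: nat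
  assumes n: "n > 0"
  shows "\<exists>L. L > 0 \<and> (\<forall>i. 1 \<le> i \<longrightarrow> i \<le> n \<longrightarrow> i dvd L) \<and> L \<le> n ^ card {p. prime p \<and> p \<le> n}"
proof -
  let ?P = "{p::nat. prime p \<and> p \<le> n}"
  have fin: "finite ?P" by simp
  define ex where "ex p = Max {k. p ^ k \<le> n}" for p :: nat
  have fin_ex: "finite {k. p ^ k \<le> n}" if "p \<in> ?P" for p
  proof (rule finite_subset)
    have "p \<ge> 2" using that prime_ge_2_nat by auto
    show "{k. p ^ k \<le> n} \<subseteq> {..n}"
    proof safe
      fix k assume "p ^ k \<le> n"
      moreover have "k < p ^ k" using \<open>p \<ge> 2\<close> less_exp power_mono[of 2 p k] by (meson le0 less_le_trans)
      ultimately show "k \<le> n" by simp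
    qed
  qed simp
  have ex_le: "p ^ ex p \<le> n" if "p \<in> ?P" for p
  proof -
    have "0 \<in> {k. p ^ k \<le> n}" using n by simp
    then have "ex p \<in> {k. p ^ k \<le> n}" unfolding ex_def using Max_in[OF fin_ex[OF that]] by blast
    then show ?thesis by simp
  qed
  let ?L = "\<Prod>p\<in>?P. p ^ ex p"
  have "?L > 0" by (rule prod_pos) (auto simp: prime_gt_0_nat)
  moreover have "i dvd ?L" if "1 \<le> i" "i \<le> n" for i
  proof -
    have "i = (\<Prod>p\<in>prime_factors i. p ^ multiplicity p i)"
      using prod_prime_factors[of i] that by simp
    also have "\<dots> dvd ?L"
    proof (rule prod_dvd_prod_subset2[OF fin])
      show sub: "prime_factors i \<subseteq> ?P"
      proof
        fix p assume p: "p \<in> prime_factors i"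
        then have "p \<le> i" using dvd_imp_le[of p i] that(1) by (simp add: in_prime_factors_iff)
        then show "p \<in> ?P" using p that(2) by (simp add: in_prime_factors_iff)
      qed
      fix p assume p: "p \<in> prime_factors i"
      with sub have "p \<in> ?P" by blast
      moreover have "p ^ multiplicity p i \<le> n"
        using dvd_imp_le[OF multiplicity_dvd[of p i]] that by simp
      ultimately have "multiplicity p i \<le> ex p" unfolding ex_def using Max_ge[OF fin_ex] by blast
      then show "p ^ multiplicity p i dvd p ^ ex p" by (rule le_imp_power_dvd)
    qed
    finally show ?thesis .
  qed
  moreover have "?L \<le> (\<Prod>p\<in>?P. n)" by (rule prod_mono) (use ex_le in auto)
  then have "?L \<le> n ^ card ?P" by simp
  ultimately show ?thesis by blast
qed

text \<open>A Chebyshev argument. With \<open>n = 2 m = 2 ^ (2 j + 1)\<close>, every common multiple of the numbers up to \<open>n\<close> is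
  divisible by \<open>m\<close> times the central binomial coefficient and is therefore at least \<open>2 ^ m\<close>. If all primes up to \<open>n\<close>
  were below \<open>2 ^ j\<close>, some common multiple would be at most \<open>n ^ 2 ^ j\<close>, which is smaller.\<close>

lemma prime_in_interval:
  assumes j: "j \<ge> 3"
  shows "\<exists>p::nat. prime p \<and> 2 ^ j \<le> p \<and> p \<le> 2 ^ (2 * j + 1)"
proof (rule ccontr)
  assume none: "\<not> ?thesis"
  define m :: nat where "m = 2 ^ (2 * j)"
  have n: "2 * m = 2 ^ (2 * j + 1)" "m > 0" by (auto simp: m_def)
  obtain L where L: "L > 0" "\<And>i. 1 \<le> i \<Longrightarrow> i \<le> 2 * m \<Longrightarrow> i dvd L"
    "L \<le> (2 * m) ^ card {p. prime p \<and> p \<le> 2 * m}"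
    using small_common_multiple[of "2 * m"] n(2) by auto
  have "{p::nat. prime p \<and> p \<le> 2 * m} \<subseteq> {..<2 ^ j}" using none n(1) by (auto simp: not_le)
  from card_mono[OF _ this] have card: "card {p::nat. prime p \<and> p \<le> 2 * m} \<le> 2 ^ j" by simp
  have "4 ^ m \<le> 2 * real (m * ((2 * m) choose m))"
    using central_binomial_lower_bound[OF n(2)] n(2) by (simp add: field_simps)
  also have "m * ((2 * m) choose m) \<le> L"
    using binomial_dvd_common_multiple[of m "2 * m" L] L(1,2) n(2) by (intro dvd_imp_le) auto
  finally have "4 ^ m \<le> 2 * real L" by simp
  then have "real (4 ^ m) \<le> real (2 * L)" by simp
  then have "4 ^ m \<le> 2 * L" by (simp only: of_nat_le_iff)
  moreover have "(4::nat) ^ m = 2 ^ m * 2 ^ m" by (simp flip: power_mult_distrib)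
  moreover have "(2::nat) \<le> 2 ^ m" using n(2) self_le_power[of 2 m] by simp
  then have "2 * (2::nat) ^ m \<le> 2 ^ m * 2 ^ m" by simp
  ultimately have "2 ^ m \<le> L" by linarith
  also have "\<dots> \<le> (2 * m) ^ 2 ^ j" using L(3) power_increasing[OF card, of "2 * m"] n(2) by linarith
  also have "\<dots> = 2 ^ ((2 * j + 1) * 2 ^ j)" by (simp only: n(1) power_mult)
  finally have "m \<le> (2 * j + 1) * 2 ^ j" by (simp only: power_increasing_iff)
  then have "2 ^ j * 2 ^ j \<le> (2 * j + 1) * 2 ^ j" by (simp only: m_def mult_2 power_add)
  then have "2 ^ j \<le> 2 * j + 1" by (rule mult_right_le_imp_le) simp
  moreover have "2 * j + 1 < 2 ^ j" using j by (induction j rule: nat_induct_at_least) auto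
  ultimately show False by simp
qed

section \<open>The speedup\<close>

text \<open>The exponent 1 will do: the sentence of level \<open>i + 5\<close> needs the axiom for some prime from
  \<open>2 ^ 2 ^ (i + 2)\<close> on. The added levels provide room for the prime and make the bound hold for all \<open>i\<close>.\<close>

theorem theorem2:
  shows "\<exists>(\<epsilon>::real) > 0. \<exists>\<phi> :: nat \<Rightarrow> fm.
    (\<forall>i. sentence (\<phi> i)) \<and>
    (\<exists>p :: nat poly. \<forall>i. fm_length (\<phi> i) \<le> poly p i) \<and>
    (\<exists>q :: nat poly. \<forall>i. \<exists>\<pi>. proves_by PrA \<pi> (\<phi> i) \<and> proof_length \<pi> \<le> poly q i) \<and>
    (\<forall>i \<pi>. proves_by PrA_alt \<pi> (\<phi> i) \<longrightarrow>
       real (proof_length \<pi>) \<ge> 2 powr (2 powr (real i powr \<epsilon>)))"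
proof -
  let ?\<phi> = "\<lambda>i. speedup_fm (i + 5)"
  have short: "\<exists>p :: nat poly. \<forall>i. fm_length (?\<phi> i) \<le> poly p i"
  proof -
    obtain C where C: "\<And>n. fm_length (speedup_fm n) \<le> C * (n + 1) ^ 4" using length_speedup_fm by blast
    \<comment> \<open>the polynomial \<open>[:6, 1:]\<close> is \<open>n + 1\<close> for the level \<open>n = i + 5\<close>\<close>
    have "fm_length (?\<phi> i) \<le> poly (smult C ([:6, 1:] ^ 4)) i" for i
      using C[of "i + 5"] by (simp add: poly_power add.commute)
    then show ?thesis by blast
  qed
  have proofs: "\<exists>q :: nat poly. \<forall>i. \<exists>\<pi>. proves_by PrA \<pi> (?\<phi> i) \<and> proof_length \<pi> \<le> poly q i"
  proof -
    obtain C where C: "\<And>n. provable_within PrA (C * (n + 1) ^ 5) (speedup_fm n)"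
      using speedup_fm_short_proof by blast
    have "provable_within PrA (poly (smult C ([:6, 1:] ^ 5)) i) (?\<phi> i)" for i
      using C[of "i + 5"] by (simp add: poly_power add.commute)
    then show ?thesis unfolding provable_within_def by blast
  qed
  have long: "2 powr (2 powr (real i powr 1)) \<le> real (proof_length \<pi>)"
    if \<pi>: "proves_by PrA_alt \<pi> (?\<phi> i)" for i \<pi>
  proof -
    have "(2::nat) ^ 2 \<le> 2 ^ (i + 2)" by (intro power_increasing) auto
    moreover have "(2::nat)\<^sup>2 = 4" by simp
    ultimately have "(3::nat) \<le> 2 ^ (i + 2)" by linarith
    then obtain P :: nat where P: "prime P" "2 ^ 2 ^ (i + 2) \<le> P" "P \<le> 2 ^ (2 * 2 ^ (i + 2) + 1)"
      using prime_in_interval by blast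
    \<comment> \<open>at level \<open>i + 5\<close> all numbers up to \<open>2 ^ 2 ^ (i + 4)\<close> are recognized\<close>
    note P(3)
    also have "2 ^ (2 * 2 ^ (i + 2) + 1) \<le> (2::nat) ^ 2 ^ (i + 4)"
      using one_le_power[of "2::nat" i] by (intro power_increasing) (simp_all add: power_add)
    finally have "P \<in> {..2 ^ 2 ^ (i + 4)}" by simp
    then have "P \<in> reach (Suc (i + 4))" using reach_interval by blast
    moreover have "Suc (i + 4) = i + 5" by simp
    ultimately have "P \<in> reach (i + 5)" by (simp only:)
    from speedup_fm_long_proof[OF P(1,2) this \<pi>]
    have "(2::nat) ^ 2 ^ (i + 2) \<le> proof_length \<pi>" .
    moreover have "(2::nat) ^ 2 ^ i \<le> 2 ^ 2 ^ (i + 2)" by (intro power_increasing) auto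
    ultimately have "(2::nat) ^ 2 ^ i \<le> proof_length \<pi>" by (rule order_trans[rotated])
    then have "real (2 ^ 2 ^ i) \<le> real (proof_length \<pi>)" by (simp only: of_nat_le_iff)
    moreover have "2 powr (2 powr (real i powr 1)) = real (2 ^ 2 ^ i)"
      using powr_realpow[of 2 i] powr_realpow[of 2 "2 ^ i"] by simp
    ultimately show ?thesis by simp
  qed
  show ?thesis
    by (rule exI[of _ 1], rule conjI[OF zero_less_one], rule exI[of _ ?\<phi>])
      (intro conjI allI impI short proofs long sentence_speedup_fm)
qed

end
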